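(* Let $G$ be a group, $\{H_\lambda\}_{\lambda\in\Lambda}$ a hyperbolically embedded collection of subgroups of $G$, and $V$ a normed $G$-module. For each $\lambda\in\Lambda$ let $U_\lambda$ be an $H_\lambda$-submodule of $V$. Then there exists an $\mathbb F$-linear map $$\iota\colon\bigoplus_{\lambda\in\Lambda}QZ^1_{as}(H_\lambda,U_\lambda)\to QZ^1_{as}(G,V)$$ such that for any $q=(q_\lambda)_{\lambda\in\Lambda}\in\bigoplus_{\lambda\in\Lambda}QZ^1_{as}(H_\lambda,U_\lambda)$ the following hold. (a) For any $\lambda\in\Lambda$ and any $h\in H_\lambda\setminus\mathcal F_\lambda$, we have $\iota(q)(h)=q_\lambda(h)$. In particular, $\sup_{h\in H_\lambda}\|\iota(q)(h)-q_\lambda(h)\|<\infty$. (b) $D(\iota(q))\le\sum_{\lambda\in\Lambda}\bigl(54K_\lambda+66D(q_\lambda)\bigr)$.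
   Context: $\mathbb F$ is a subfield of $\mathbb C$; modules are left, vector spaces are over $\mathbb F$. A normed $G$-module is a normed vector space $V$ with a left action of $G$ by (linear) isometries; an $H$-submodule ($H\le G$) is an $H$-invariant subspace. A map $q\colon G\to V$ is a quasi-cocycle if its defect $D(q)=\sup_{f,g\in G}\|q(fg)-q(f)-fq(g)\|$ is finite; it is anti-symmetric if $q(g^{-1})=-g^{-1}q(g)$ for all $g$. $QZ^1_{as}(G,V)$ is the vector space of anti-symmetric quasi-cocycles. Hyperbolically embedded collections: for subgroups $\{H_\lambda\}_{\lambda\in\Lambda}$ of $G$ put $\mathcal H=\bigsqcup_\lambda(H_\lambda\setminus\{1\})$ (disjoint union). For $X\subseteq G$ with $G$ generated by $X\cup\bigcup_\lambda H_\lambda$, let $\Gamma=\Gamma(G,X\sqcup\mathcal H)$ be the Cayley graph with edges labeled by letters of $X\sqcup\mathcal H$ (multiple edges when letters represent the same element). For $h,k\in H_\lambda$ let $\widehat d_\lambda(h,k)\in[0,\infty]$ be the length of a shortest path in $\Gamma$ from $h$ to $k$ with no edges in the complete subgraph $\Gamma(H_\lambda,H_\lambda\setminus\{1\})$ ($\infty$ if none). Extend to $G$ by $\widehat d_\lambda(f,g)=\widehat d_\lambda(f^{-1}g,1)$ if $f^{-1}g\in H_\lambda$, and $\infty$ otherwise. The collection is hyperbolically embedded in $G$ with respect to $X$ if $\Gamma$ is Gromov hyperbolic and each $(H_\lambda,\widehat d_\lambda)$ is locally finite (balls of finite radius are finite); it is hyperbolically embedded in $G$ if this holds for some (not necessarily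 finite) $X\subseteq G$. Fix such an $X$. The constant $C$: an $H_\lambda$-component of a path $q$ in $\Gamma$ is a maximal nontrivial subpath labeled by a word in the alphabet $H_\lambda\setminus\{1\}$ (for a loop, maximal also in all cyclic shifts). Two $H_\lambda$-components are connected if their vertices all lie in the same left coset of $H_\lambda$; an $H_\lambda$-component is isolated if it is not connected to any other $H_\lambda$-component of the path. A geodesic $n$-gon is a loop that is a concatenation of $n$ geodesics. There is a constant $C>0$ such that for every geodesic $n$-gon $p$ in $\Gamma$ and every isolated $H_\lambda$-component $a$ of $p$ (any $\lambda$), with endpoints $a_-,a_+$, one has $\widehat d_\lambda(a_-,a_+)\le Cn$; fix such $C$. Finally, $\mathcal F_\lambda=\{h\in H_\lambda\mid h\in H_\mu\text{ for some }\mu\ne\lambda\}$, and $K_\lambda=\max\{\|q_\lambda(g)\| : g\in H_\lambda,\ \widehat d_\lambda(1,g)<15C\}$. (Only finitely many $q_\lambda$ are nonzero, so the sum in (b) is finite.) *)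

theory Defs
  imports
    Complex_Main
    "HOL-Library.Extended_Real"
    "HOL-Algebra.Subrings"
    "HOL-Algebra.Group_Action"
    "HOL-Algebra.Generated_Groups"
begin

section \<open>Normed modules over a subfield of the complex numbers\<close>

definition complex_ring :: "complex ring" where
  "complex_ring = \<lparr>carrier = UNIV, mult = (*), one = 1, zero = 0, add = (+)\<rparr>"

text \<open>
  The scalars form a set \<open>F\<close> of complex numbers, so \<open>scale c v\<close> is meaningful only for \<open>c \<in> F\<close>;
  its values for other \<open>c\<close> are never used.
\<close>

locale normed_space_over =
  fixes F :: "complex set"
    and scale :: "complex \<Rightarrow> 'v::ab_group_add \<Rightarrow> 'v"
    and nrm :: "'v \<Rightarrow> real"
  assumes subfield_F: "subfield F complex_ring"
    and scale_right_distrib: "c \<in> F \<Longrightarrow> scale c (v + w) = scale c v + scale c w"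
    and scale_left_distrib: "c \<in> F \<Longrightarrow> d \<in> F \<Longrightarrow> scale (c + d) v = scale c v + scale d v"
    and scale_scale: "c \<in> F \<Longrightarrow> d \<in> F \<Longrightarrow> scale c (scale d v) = scale (c * d) v"
    and scale_one: "scale 1 v = v"
    and nrm_nonneg: "0 \<le> nrm v"
    and nrm_eq_0_iff: "nrm v = 0 \<longleftrightarrow> v = 0"
    and nrm_triangle: "nrm (v + w) \<le> nrm v + nrm w"
    and nrm_scale: "c \<in> F \<Longrightarrow> nrm (scale c v) = cmod c * nrm v"

locale normed_G_module =
  normed_space_over F scale nrm + group_action G UNIV act
  for F :: "complex set"
    and scale :: "complex \<Rightarrow> 'v::ab_group_add \<Rightarrow> 'v"
    and nrm :: "'v \<Rightarrow> real"
    and G :: "('g, 'm) monoid_scheme" (structure)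
    and act :: "'g \<Rightarrow> 'v \<Rightarrow> 'v" +
  assumes act_add: "g \<in> carrier G \<Longrightarrow> act g (v + w) = act g v + act g w"
    and act_scale: "g \<in> carrier G \<Longrightarrow> c \<in> F \<Longrightarrow> act g (scale c v) = scale c (act g v)"
    and act_isometry: "g \<in> carrier G \<Longrightarrow> nrm (act g v) = nrm v"

definition invariant_subspace ::
    "complex set \<Rightarrow> (complex \<Rightarrow> 'v::ab_group_add \<Rightarrow> 'v) \<Rightarrow> ('g \<Rightarrow> 'v \<Rightarrow> 'v) \<Rightarrow> 'g set \<Rightarrow> 'v set \<Rightarrow> bool"
  where
  "invariant_subspace F scale act H U \<longleftrightarrow>
     0 \<in> U \<and> (\<forall>u\<in>U. \<forall>v\<in>U. u + v \<in> U) \<and> (\<forall>c\<in>F. \<forall>u\<in>U. scale c u \<in> U) \<and>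
     (\<forall>h\<in>H. \<forall>u\<in>U. act h u \<in> U)"


section \<open>Quasi-cocycles\<close>

definition defects ::
    "('g, 'm) monoid_scheme \<Rightarrow> ('g \<Rightarrow> 'v::ab_group_add \<Rightarrow> 'v) \<Rightarrow> ('v \<Rightarrow> real) \<Rightarrow> 'g set \<Rightarrow> ('g \<Rightarrow> 'v) \<Rightarrow> real set"
  where
  "defects G act nrm H q = {nrm (q (f \<otimes>\<^bsub>G\<^esub> g) - q f - act f (q g)) | f g. f \<in> H \<and> g \<in> H}"

text \<open>
  The supremum is a real one, so \<open>defect\<close> is meaningful only when the set of defects is bounded;
  this is part of membership in \<open>QZas\<close>.
\<close>

definition defect ::
    "('g, 'm) monoid_scheme \<Rightarrow> ('g \<Rightarrow> 'v::ab_group_add \<Rightarrow> 'v) \<Rightarrow> ('v \<Rightarrow> real) \<Rightarrow> 'g set \<Rightarrow> ('g \<Rightarrow> 'v) \<Rightarrow> real"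
  where
  "defect G act nrm H q = Sup (defects G act nrm H q)"

text \<open>
  Anti-symmetric quasi-cocycles on the subgroup \<open>H\<close> of \<open>G\<close> with values in \<open>U\<close>. A map on \<open>H\<close> is
  represented by its extension by \<open>0\<close> to the type \<open>'g\<close>, so the vector space operations
  are the pointwise ones.
\<close>

definition QZas ::
    "('g, 'm) monoid_scheme \<Rightarrow> ('g \<Rightarrow> 'v::ab_group_add \<Rightarrow> 'v) \<Rightarrow> ('v \<Rightarrow> real) \<Rightarrow> 'g set \<Rightarrow> 'v set \<Rightarrow> ('g \<Rightarrow> 'v) set"
  where
  "QZas G act nrm H U =
     {q. (\<forall>h\<in>H. q h \<in> U) \<and> (\<forall>g. g \<notin> H \<longrightarrow> q g = 0) \<and>
         bdd_above (defects G act nrm H q) \<and>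
         (\<forall>h\<in>H. q (inv\<^bsub>G\<^esub> h) = - act (inv\<^bsub>G\<^esub> h) (q h))}"

definition QZas_sum ::
    "('g, 'm) monoid_scheme \<Rightarrow> ('g \<Rightarrow> 'v::ab_group_add \<Rightarrow> 'v) \<Rightarrow> ('v \<Rightarrow> real) \<Rightarrow>
     'l set \<Rightarrow> ('l \<Rightarrow> 'g set) \<Rightarrow> ('l \<Rightarrow> 'v set) \<Rightarrow> ('l \<Rightarrow> 'g \<Rightarrow> 'v) set"
  where
  "QZas_sum G act nrm \<Lambda> H U =
     {q. (\<forall>l\<in>\<Lambda>. q l \<in> QZas G act nrm (H l) (U l)) \<and> (\<forall>l. l \<notin> \<Lambda> \<longrightarrow> q l = (\<lambda>_. 0)) \<and>
         finite {l. q l \<noteq> (\<lambda>_. 0)}}"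


section \<open>Paths in the Cayley graph\<close>

text \<open>
  The two constructors keep the alphabet \<open>X \<squnion> \<H>\<close> a disjoint union, even when the letters represent
  the same element of the group.
\<close>

datatype ('g, 'l) letter = XLetter 'g | HLetter 'l 'g

fun letter_elt :: "('g, 'l) letter \<Rightarrow> 'g" where
  "letter_elt (XLetter x) = x"
| "letter_elt (HLetter l h) = h"

fun is_HLetter :: "'l \<Rightarrow> ('g, 'l) letter \<Rightarrow> bool" where
  "is_HLetter l (XLetter x) = False"
| "is_HLetter l (HLetter k h) = (k = l)"

definition alphabet ::
    "('g, 'm) monoid_scheme \<Rightarrow> 'l set \<Rightarrow> ('l \<Rightarrow> 'g set) \<Rightarrow> 'g set \<Rightarrow> ('g, 'l) letter set"
  where
  "alphabet G \<Lambda> H X = XLetter ` X \<union> {HLetter l h | l h. l \<in> \<Lambda> \<and> h \<in> H l - {\<one>\<^bsub>G\<^esub>}}"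

text \<open>
  A path is given by its starting vertex and the edges it traverses. The pair \<open>(a, True)\<close> is the edge
  labeled \<open>a\<close> from \<open>g\<close> to \<open>g a\<close> followed along its orientation, and \<open>(a, False)\<close> is the edge labeled
  \<open>a\<close> from \<open>g a\<^sup>-\<^sup>1\<close> to \<open>g\<close> followed against it, since \<open>X\<close> need not be symmetric. Traversing an
  edge labeled \<open>h\<close> of an \<open>H\<close>-letter backwards reads \<open>h\<^sup>-\<^sup>1\<close>, again an element of \<open>H\<^sub>\<lambda> \<setminus> {1}\<close>.
\<close>

type_synonym ('g, 'l) path = "'g \<times> (('g, 'l) letter \<times> bool) list"

definition path_length :: "('g, 'l) path \<Rightarrow> nat" where
  "path_length p = length (snd p)"

definition step_elt :: "('g, 'm) monoid_scheme \<Rightarrow> ('g, 'l) letter \<times> bool \<Rightarrow> 'g" where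
  "step_elt G s = (if snd s then letter_elt (fst s) else inv\<^bsub>G\<^esub> (letter_elt (fst s)))"

definition vertex :: "('g, 'm) monoid_scheme \<Rightarrow> ('g, 'l) path \<Rightarrow> nat \<Rightarrow> 'g" where
  "vertex G p i = foldl (\<lambda>g s. g \<otimes>\<^bsub>G\<^esub> step_elt G s) (fst p) (take i (snd p))"

definition path_start :: "('g, 'l) path \<Rightarrow> 'g" where
  "path_start p = fst p"

definition path_end :: "('g, 'm) monoid_scheme \<Rightarrow> ('g, 'l) path \<Rightarrow> 'g" where
  "path_end G p = vertex G p (path_length p)"

definition edge_letter :: "('g, 'l) path \<Rightarrow> nat \<Rightarrow> ('g, 'l) letter" where
  "edge_letter p i = fst (snd p ! i)"

definition is_path ::
    "('g, 'm) monoid_scheme \<Rightarrow> 'l set \<Rightarrow> ('l \<Rightarrow> 'g set) \<Rightarrow> 'g set \<Rightarrow> ('g, 'l) path \<Rightarrow> bool"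
  where
  "is_path G \<Lambda> H X p \<longleftrightarrow>
     path_start p \<in> carrier G \<and> (\<forall>s\<in>set (snd p). fst s \<in> alphabet G \<Lambda> H X)"

definition paths_between ::
    "('g, 'm) monoid_scheme \<Rightarrow> 'l set \<Rightarrow> ('l \<Rightarrow> 'g set) \<Rightarrow> 'g set \<Rightarrow> 'g \<Rightarrow> 'g \<Rightarrow> ('g, 'l) path set"
  where
  "paths_between G \<Lambda> H X x y =
     {p. is_path G \<Lambda> H X p \<and> path_start p = x \<and> path_end G p = y}"

definition cayley_dist ::
    "('g, 'm) monoid_scheme \<Rightarrow> 'l set \<Rightarrow> ('l \<Rightarrow> 'g set) \<Rightarrow> 'g set \<Rightarrow> 'g \<Rightarrow> 'g \<Rightarrow> enat"
  where
  "cayley_dist G \<Lambda> H X x y = (INF p\<in>paths_between G \<Lambda> H X x y. enat (path_length p))"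

definition geodesic_path ::
    "('g, 'm) monoid_scheme \<Rightarrow> 'l set \<Rightarrow> ('l \<Rightarrow> 'g set) \<Rightarrow> 'g set \<Rightarrow> ('g, 'l) path \<Rightarrow> bool"
  where
  "geodesic_path G \<Lambda> H X p \<longleftrightarrow>
     is_path G \<Lambda> H X p \<and>
     enat (path_length p) = cayley_dist G \<Lambda> H X (path_start p) (path_end G p)"


section \<open>Hyperbolically embedded collections\<close>

text \<open>
  Thin geodesic triangles. Triangles with corners at vertices of the graph suffice and only the
  vertices on their sides are inspected, since each point of a graph is within \<open>1/2\<close> of a vertex.
  The condition on \<open>p\<close> covers the other two sides by cyclic renaming.
\<close>

definition hyperbolic_cayley_graph ::
    "('g, 'm) monoid_scheme \<Rightarrow> 'l set \<Rightarrow> ('l \<Rightarrow> 'g set) \<Rightarrow> 'g set \<Rightarrow> bool"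
  where
  "hyperbolic_cayley_graph G \<Lambda> H X \<longleftrightarrow>
     (\<exists>\<delta>::nat. \<forall>p q r.
        geodesic_path G \<Lambda> H X p \<and> geodesic_path G \<Lambda> H X q \<and> geodesic_path G \<Lambda> H X r \<and>
        path_end G p = path_start q \<and> path_end G q = path_start r \<and> path_end G r = path_start p \<longrightarrow>
        (\<forall>i\<le>path_length p.
           (\<exists>j\<le>path_length q. cayley_dist G \<Lambda> H X (vertex G p i) (vertex G q j) \<le> enat \<delta>) \<or>
           (\<exists>j\<le>path_length r. cayley_dist G \<Lambda> H X (vertex G p i) (vertex G r j) \<le> enat \<delta>)))"

text \<open>
  \<open>rel_dist\<close> is the metric on \<open>H l\<close>; the infimum over the empty set is \<open>\<infinity>\<close>. An edge lies in the
  complete subgraph on \<open>H l\<close> iff it is labeled by a letter of \<open>H l\<close> and joins two elements of \<open>H l\<close>.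
  Other edges between elements of \<open>H l\<close> are allowed, and so are edges labeled by letters of \<open>H l\<close>
  in other cosets.
\<close>

definition rel_dist ::
    "('g, 'm) monoid_scheme \<Rightarrow> 'l set \<Rightarrow> ('l \<Rightarrow> 'g set) \<Rightarrow> 'g set \<Rightarrow> 'l \<Rightarrow> 'g \<Rightarrow> 'g \<Rightarrow> enat"
  where
  "rel_dist G \<Lambda> H X l h k =
     (INF p\<in>{p \<in> paths_between G \<Lambda> H X h k.
               \<forall>i<path_length p. \<not> (is_HLetter l (edge_letter p i) \<and>
                                    vertex G p i \<in> H l \<and> vertex G p (Suc i) \<in> H l)}.
        enat (path_length p))"

definition rel_dist_ext ::
    "('g, 'm) monoid_scheme \<Rightarrow> 'l set \<Rightarrow> ('l \<Rightarrow> 'g set) \<Rightarrow> 'g set \<Rightarrow> 'l \<Rightarrow> 'g \<Rightarrow> 'g \<Rightarrow> enat"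
  where
  "rel_dist_ext G \<Lambda> H X l f g =
     (if inv\<^bsub>G\<^esub> f \<otimes>\<^bsub>G\<^esub> g \<in> H l
      then rel_dist G \<Lambda> H X l (inv\<^bsub>G\<^esub> f \<otimes>\<^bsub>G\<^esub> g) \<one>\<^bsub>G\<^esub> else \<infinity>)"

definition hyp_embedded_wrt ::
    "('g, 'm) monoid_scheme \<Rightarrow> 'l set \<Rightarrow> ('l \<Rightarrow> 'g set) \<Rightarrow> 'g set \<Rightarrow> bool"
  where
  "hyp_embedded_wrt G \<Lambda> H X \<longleftrightarrow>
     (\<forall>l\<in>\<Lambda>. subgroup (H l) G) \<and>
     X \<subseteq> carrier G \<and>
     generate G (X \<union> (\<Union>l\<in>\<Lambda>. H l)) = carrier G \<and>
     hyperbolic_cayley_graph G \<Lambda> H X \<and>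
     (\<forall>l\<in>\<Lambda>. \<forall>h\<in>H l. \<forall>r::nat. finite {k \<in> H l. rel_dist G \<Lambda> H X l h k \<le> enat r})"


section \<open>Components of geodesic polygons\<close>

definition geodesic_ngon ::
    "('g, 'm) monoid_scheme \<Rightarrow> 'l set \<Rightarrow> ('l \<Rightarrow> 'g set) \<Rightarrow> 'g set \<Rightarrow> nat \<Rightarrow> ('g, 'l) path \<Rightarrow> bool"
  where
  "geodesic_ngon G \<Lambda> H X n p \<longleftrightarrow>
     (\<exists>ps. ps \<noteq> [] \<and> length ps = n \<and> (\<forall>s\<in>set ps. geodesic_path G \<Lambda> H X s) \<and>
           (\<forall>i<n. path_end G (ps ! i) = path_start (ps ! (Suc i mod n))) \<and>
           p = (path_start (hd ps), concat (map snd ps)))"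

text \<open>
  Subpaths of cyclic shifts of a loop \<open>p\<close> are described by cyclic intervals: \<open>(i, m)\<close> stands for
  the \<open>m\<close> consecutive edges starting with edge number \<open>i\<close>, counted modulo the length of \<open>p\<close>.
\<close>

definition arc_edges :: "('g, 'l) path \<Rightarrow> nat \<Rightarrow> nat \<Rightarrow> nat set" where
  "arc_edges p i m = (\<lambda>k. (i + k) mod path_length p) ` {..<m}"

definition arc_vertices :: "('g, 'm) monoid_scheme \<Rightarrow> ('g, 'l) path \<Rightarrow> nat \<Rightarrow> nat \<Rightarrow> 'g set" where
  "arc_vertices G p i m = (\<lambda>k. vertex G p ((i + k) mod path_length p)) ` {..m}"

definition H_arc :: "'l \<Rightarrow> ('g, 'l) path \<Rightarrow> nat \<Rightarrow> nat \<Rightarrow> bool" where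
  "H_arc l p i m \<longleftrightarrow>
     i < path_length p \<and> 0 < m \<and> m \<le> path_length p \<and>
     (\<forall>j\<in>arc_edges p i m. is_HLetter l (edge_letter p j))"

definition loop_component :: "'l \<Rightarrow> ('g, 'l) path \<Rightarrow> nat \<Rightarrow> nat \<Rightarrow> bool" where
  "loop_component l p i m \<longleftrightarrow>
     H_arc l p i m \<and>
     \<not> (\<exists>i' m'. H_arc l p i' m' \<and> arc_edges p i m \<subset> arc_edges p i' m')"

definition connected_arcs ::
    "('g, 'm) monoid_scheme \<Rightarrow> 'g set \<Rightarrow> ('g, 'l) path \<Rightarrow> nat \<Rightarrow> nat \<Rightarrow> nat \<Rightarrow> nat \<Rightarrow> bool"
  where
  "connected_arcs G K p i m i' m' \<longleftrightarrow>
     (\<exists>x\<in>carrier G. arc_vertices G p i m \<union> arc_vertices G p i' m' \<subseteq> x <#\<^bsub>G\<^esub> K)"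

definition isolated_component ::
    "('g, 'm) monoid_scheme \<Rightarrow> ('l \<Rightarrow> 'g set) \<Rightarrow> 'l \<Rightarrow> ('g, 'l) path \<Rightarrow> nat \<Rightarrow> nat \<Rightarrow> bool"
  where
  "isolated_component G H l p i m \<longleftrightarrow>
     loop_component l p i m \<and>
     (\<forall>i' m'. loop_component l p i' m' \<and> arc_edges p i' m' \<noteq> arc_edges p i m \<longrightarrow>
              \<not> connected_arcs G (H l) p i m i' m')"

definition polygon_constant ::
    "('g, 'm) monoid_scheme \<Rightarrow> 'l set \<Rightarrow> ('l \<Rightarrow> 'g set) \<Rightarrow> 'g set \<Rightarrow> real \<Rightarrow> bool"
  where
  "polygon_constant G \<Lambda> H X C \<longleftrightarrow>
     (\<forall>n p l i m.
        geodesic_ngon G \<Lambda> H X n p \<and> l \<in> \<Lambda> \<and> isolated_component G H l p i m \<longrightarrow>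
        ereal_of_enat (rel_dist_ext G \<Lambda> H X l
          (vertex G p i) (vertex G p ((i + m) mod path_length p))) \<le> ereal (C * real n))"


section \<open>The constants of the extension theorem\<close>

definition overlap :: "'l set \<Rightarrow> ('l \<Rightarrow> 'g set) \<Rightarrow> 'l \<Rightarrow> 'g set" where
  "overlap \<Lambda> H l = {h \<in> H l. \<exists>k\<in>\<Lambda>. k \<noteq> l \<and> h \<in> H k}"

text \<open>For a hyperbolically embedded collection the maximum is over a finite set containing \<open>\<one>\<close>.\<close>

definition K_const ::
    "('g, 'm) monoid_scheme \<Rightarrow> ('v \<Rightarrow> real) \<Rightarrow> 'l set \<Rightarrow> ('l \<Rightarrow> 'g set) \<Rightarrow> 'g set \<Rightarrow> real \<Rightarrow>
     'l \<Rightarrow> ('g \<Rightarrow> 'v) \<Rightarrow> real"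
  where
  "K_const G nrm \<Lambda> H X C l q =
     Max {nrm (q g) | g. g \<in> H l \<and>
            ereal_of_enat (rel_dist_ext G \<Lambda> H X l \<one>\<^bsub>G\<^esub> g) < ereal (15 * C)}"

end

theory Submission
  imports Defs
begin

text \<open>
  Write \<open>d\<close> for the word metric of \<open>X \<squnion> \<H>\<close> on \<open>G\<close> and call a pair \<open>(l, A)\<close>, with \<open>A\<close> a left coset of
  \<open>H\<^sub>l\<close>, a coset. For a point \<open>x\<close> let the projection of \<open>x\<close> be the set of points of \<open>A\<close> nearest to \<open>x\<close>.
  Two points of \<open>A\<close> are joined by an edge, so a geodesic from \<open>x\<close> to \<open>y\<close> that runs along an
  \<open>H\<^sub>l\<close>-edge in \<open>A\<close> enters \<open>A\<close> at a nearest point of \<open>x\<close> and leaves it at a nearest point of \<open>y\<close>, and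
  \<open>d(x,y) = d(x,A) + 1 + d(y,A)\<close>. The polygon constant is applied in one way only
  (\<open>near_if_sides_avoid\<close>): if the points \<open>u\<close>, \<open>v\<close> of \<open>A\<close> are joined outside of \<open>A\<close> by at most
  four geodesics, then the letter \<open>u\<^sup>-\<^sup>1 v\<close> closes them up to a pentagon in which it is an isolated
  component, so the relative distance of \<open>u\<close> and \<open>v\<close> is at most \<open>5 C\<close>. Consequently projections are
  finite, of diameter at most \<open>5 C\<close>, and if the projections of \<open>x\<close> and \<open>y\<close> contain points more than
  \<open>5 C\<close> apart, then every geodesic from \<open>x\<close> to \<open>y\<close> crosses \<open>A\<close>. If they contain points more than
  \<open>14 C\<close> apart, \<open>A\<close> is said to separate \<open>x\<close> and \<open>y\<close>; a given pair of points is separated by finitely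
  many cosets only.

  Each coset \<open>(l, A)\<close> contributes to a pair \<open>x\<close>, \<open>y\<close> the average of \<open>a q\<^sub>l(a\<^sup>-\<^sup>1 b)\<close> over all \<open>a\<close> in
  the projection of \<open>x\<close> and \<open>b\<close> in the projection of \<open>y\<close>, and \<open>bicombing q x y\<close> is the sum of the
  contributions of the separating cosets. It is linear in \<open>q\<close>, equivariant, and changes sign when \<open>x\<close>
  and \<open>y\<close> are exchanged, so \<open>g \<mapsto> bicombing q 1 g\<close> is anti-symmetric, and its defect at \<open>(f, g)\<close> is
  the norm of the sum of \<open>bicombing q\<close> around the triangle \<open>1\<close>, \<open>f\<close>, \<open>fg\<close>.

  That sum is bounded coset by coset. Without the truncation at \<open>14 C\<close> the three terms of a coset
  add up to at most the defect \<open>D(q\<^sub>l)\<close>, and each truncation changes a term by at most \<open>K\<^sub>l\<close>, because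
  \<open>14 C < 15 C\<close>. If two of the three projections agree, the terms cancel. Otherwise there is a corner
  whose projection is more than \<open>7 C\<close> away from the projections of the two other corners, and these two
  differ. The geodesics from that corner to the two others cross all cosets of this kind in the same
  order, and they can be exchanged at the last one, which makes the two projections to every
  earlier one equal; hence there is only one for each corner (\<open>branching_unique\<close>). At most three
  cosets remain, and the triangle sum is at most three times the sum over \<open>l\<close> of \<open>3 K\<^sub>l + D(q\<^sub>l)\<close>.

  For \<open>h \<in> H\<^sub>l\<close> the only coset that can separate \<open>1\<close> and \<open>h\<close> is \<open>H\<^sub>l\<close> itself, so \<open>bicombing q 1 h\<close> is
  \<open>q\<^sub>l(h)\<close>, or \<open>0\<close> when \<open>h\<close> is so close to \<open>1\<close> that \<open>q\<^sub>l(h)\<close> has norm at most \<open>K\<^sub>l\<close>. Replacing the value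
  by \<open>q\<^sub>l(h)\<close> for all \<open>h\<close> that lie in exactly one \<open>H\<^sub>l\<close> thus gives an extension with the
  values required on the subgroups and adds at most three times the sum of the \<open>K\<^sub>l\<close> to the defect,
  for a total of at most \<open>12 K\<^sub>l + 3 D(q\<^sub>l)\<close> for each \<open>l\<close>.
\<close>

section \<open>Words and the word metric\<close>

locale embedded_collection = group G for G :: "('g, 'm) monoid_scheme" (structure) +
  fixes \<Lambda> :: "'l set" and H :: "'l \<Rightarrow> 'g set" and X :: "'g set" and C :: real
  assumes embedded: "hyp_embedded_wrt G \<Lambda> H X"
    and C_pos: "C > 0"
    and polygons: "polygon_constant G \<Lambda> H X C"
begin

definition word :: "(('g, 'l) letter \<times> bool) list \<Rightarrow> bool" where
  "word es \<longleftrightarrow> (\<forall>s\<in>set es. fst s \<in> alphabet G \<Lambda> H X)"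

primrec word_elt :: "(('g, 'l) letter \<times> bool) list \<Rightarrow> 'g" where
  "word_elt [] = \<one>"
| "word_elt (s # es) = step_elt G s \<otimes> word_elt es"

definition inv_word :: "(('g, 'l) letter \<times> bool) list \<Rightarrow> (('g, 'l) letter \<times> bool) list" where
  "inv_word es = rev (map (\<lambda>(a, b). (a, \<not> b)) es)"

lemma subgroup_H: "l \<in> \<Lambda> \<Longrightarrow> subgroup (H l) G"
  using embedded by (simp add: hyp_embedded_wrt_def)

lemma H_closed: "l \<in> \<Lambda> \<Longrightarrow> h \<in> H l \<Longrightarrow> h \<in> carrier G"
  using subgroup_H subgroup.mem_carrier by fast

lemma H_one: "l \<in> \<Lambda> \<Longrightarrow> \<one> \<in> H l"
  using subgroup_H subgroup.one_closed by fast

lemma H_inv: "l \<in> \<Lambda> \<Longrightarrow> h \<in> H l \<Longrightarrow> inv h \<in> H l"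
  using subgroup_H subgroup.m_inv_closed by fast

lemma H_mult: "l \<in> \<Lambda> \<Longrightarrow> h \<in> H l \<Longrightarrow> k \<in> H l \<Longrightarrow> h \<otimes> k \<in> H l"
  using subgroup_H subgroup.m_closed by fast

lemma inv_mult_cancel [simp]:
  assumes "g \<in> carrier G" "x \<in> carrier G"
  shows "inv g \<otimes> (g \<otimes> x) = x" "g \<otimes> (inv g \<otimes> x) = x"
  using assms by (simp_all flip: m_assoc)

lemma letter_closed: "a \<in> alphabet G \<Lambda> H X \<Longrightarrow> letter_elt a \<in> carrier G"
  using embedded H_closed by (auto simp: alphabet_def hyp_embedded_wrt_def)

lemma step_closed: "fst s \<in> alphabet G \<Lambda> H X \<Longrightarrow> step_elt G s \<in> carrier G"
  using letter_closed by (simp add: step_elt_def)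

lemma word_simps [simp]:
  "word []" "word (s # es) \<longleftrightarrow> fst s \<in> alphabet G \<Lambda> H X \<and> word es"
  "word (es @ es') \<longleftrightarrow> word es \<and> word es'"
  by (auto simp: word_def)

lemma word_elt_closed [simp]: "word es \<Longrightarrow> word_elt es \<in> carrier G"
  by (induction es) (auto simp: step_closed)

lemma word_take: "word es \<Longrightarrow> word (take i es)"
  by (auto simp: word_def dest: in_set_takeD)

lemma word_elt_append:
  "word es \<Longrightarrow> word es' \<Longrightarrow> word_elt (es @ es') = word_elt es \<otimes> word_elt es'"
  by (induction es) (auto simp: step_closed m_assoc)

lemma inv_word_simps [simp]:
  "inv_word [] = []" "inv_word (s # es) = inv_word es @ [(fst s, \<not> snd s)]"
  "length (inv_word es) = length es" "word (inv_word es) \<longleftrightarrow> word es"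
  by (auto simp: inv_word_def word_def split: prod.splits)

lemma step_inv: "fst s \<in> alphabet G \<Lambda> H X \<Longrightarrow> step_elt G (fst s, \<not> snd s) = inv (step_elt G s)"
  using letter_closed by (auto simp: step_elt_def)

lemma word_elt_inv_word: "word es \<Longrightarrow> word_elt (inv_word es) = inv (word_elt es)"
  by (induction es) (auto simp: word_elt_append step_inv step_closed inv_mult_group)

lemma vertex_eq:
  assumes "word es" "x \<in> carrier G"
  shows "vertex G (x, es) i = x \<otimes> word_elt (take i es)"
proof -
  have "foldl (\<lambda>g s. g \<otimes> step_elt G s) x es' = x \<otimes> word_elt es'"
    if "word es'" "x \<in> carrier G" for es' and x
    using that by (induction es' arbitrary: x) (auto simp: step_closed m_assoc)
  then show ?thesis
    using assms by (simp add: vertex_def word_take)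
qed

lemma H_letter_step:
  assumes "fst s \<in> alphabet G \<Lambda> H X" "is_HLetter l (fst s)"
  shows "l \<in> \<Lambda>" "step_elt G s \<in> H l"
  using assms H_inv by (auto simp: alphabet_def step_elt_def)

lemma HLetter_in_alphabet:
  "l \<in> \<Lambda> \<Longrightarrow> h \<in> H l \<Longrightarrow> h \<noteq> \<one> \<Longrightarrow> HLetter l h \<in> alphabet G \<Lambda> H X"
  by (auto simp: alphabet_def)

lemma word_elt_surj: "g \<in> carrier G \<Longrightarrow> \<exists>es. word es \<and> word_elt es = g"
proof -
  have letter: "\<exists>es. word es \<and> word_elt es = h" if h: "h \<in> X \<union> (\<Union>l\<in>\<Lambda>. H l)" for h
  proof (cases "h = \<one>")
    case True
    then show ?thesis by (intro exI[of _ "[]"]) simp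
  next
    case False
    have "\<exists>a\<in>alphabet G \<Lambda> H X. letter_elt a = h"
    proof (cases "h \<in> X")
      case True
      then show ?thesis by (intro bexI[of _ "XLetter h"]) (simp_all add: alphabet_def)
    next
      case nX: False
      then obtain l where "l \<in> \<Lambda>" "h \<in> H l" using h by blast
      then show ?thesis using False by (intro bexI[of _ "HLetter l h"]) (simp_all add: alphabet_def)
    qed
    then obtain a where a: "a \<in> alphabet G \<Lambda> H X" "letter_elt a = h" by blast
    have "h \<in> carrier G" using letter_closed[OF a(1)] a(2) by simp
    then show ?thesis using a by (intro exI[of _ "[(a, True)]"]) (simp add: step_elt_def)
  qed
  have "\<exists>es. word es \<and> word_elt es = g" if "g \<in> generate G (X \<union> (\<Union>l\<in>\<Lambda>. H l))" for g
    using that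
  proof (induction rule: generate.induct)
    case one
    show ?case by (intro exI[of _ "[]"]) simp
  next
    case (incl h)
    then show ?case using letter by blast
  next
    case (inv h)
    then obtain es where "word es" "word_elt es = h" using letter by blast
    then show ?case by (intro exI[of _ "inv_word es"]) (simp add: word_elt_inv_word)
  next
    case (eng h1 h2)
    then obtain es1 es2 where "word es1" "word_elt es1 = h1" "word es2" "word_elt es2 = h2" by blast
    then show ?case by (intro exI[of _ "es1 @ es2"]) (simp add: word_elt_append)
  qed
  then show "g \<in> carrier G \<Longrightarrow> \<exists>es. word es \<and> word_elt es = g"
    using embedded by (simp add: hyp_embedded_wrt_def)
qed

definition gdist :: "'g \<Rightarrow> 'g \<Rightarrow> nat" where
  "gdist x y = (LEAST n. \<exists>es. word es \<and> word_elt es = inv x \<otimes> y \<and> length es = n)"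

definition geodesic :: "'g \<Rightarrow> (('g, 'l) letter \<times> bool) list \<Rightarrow> 'g \<Rightarrow> bool" where
  "geodesic x es y \<longleftrightarrow> x \<in> carrier G \<and> word es \<and> x \<otimes> word_elt es = y \<and> length es = gdist x y"

lemma gdist_le:
  assumes "x \<in> carrier G" "word es"
  shows "gdist x (x \<otimes> word_elt es) \<le> length es"
  unfolding gdist_def by (rule Least_le) (use assms in auto)

lemma geodesic_exists:
  assumes "x \<in> carrier G" "y \<in> carrier G"
  shows "\<exists>es. geodesic x es y"
proof -
  have "\<exists>n es. word es \<and> word_elt es = inv x \<otimes> y \<and> length es = n"
    using word_elt_surj[of "inv x \<otimes> y"] assms by auto
  then have "\<exists>es. word es \<and> word_elt es = inv x \<otimes> y \<and> length es = gdist x y"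
    unfolding gdist_def by (rule LeastI_ex)
  then show ?thesis using assms by (auto simp: geodesic_def)
qed

lemma gdist_translate:
  "g \<in> carrier G \<Longrightarrow> x \<in> carrier G \<Longrightarrow> y \<in> carrier G \<Longrightarrow> gdist (g \<otimes> x) (g \<otimes> y) = gdist x y"
  by (simp add: gdist_def inv_mult_group m_assoc)

lemma gdist_triangle:
  assumes "x \<in> carrier G" "y \<in> carrier G" "z \<in> carrier G"
  shows "gdist x z \<le> gdist x y + gdist y z"
proof -
  obtain p where p: "geodesic x p y" using geodesic_exists assms by blast
  obtain q where q: "geodesic y q z" using geodesic_exists assms by blast
  note p' = p[unfolded geodesic_def] and q' = q[unfolded geodesic_def]
  have "x \<otimes> word_elt (p @ q) = z"
    using p' q' assms by (simp add: word_elt_append flip: m_assoc)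
  then show ?thesis using gdist_le[of x "p @ q"] p' q' assms by simp
qed

lemma gdist_commute:
  assumes "x \<in> carrier G" "y \<in> carrier G"
  shows "gdist x y = gdist y x"
proof -
  have "gdist y x \<le> gdist x y" if xy: "x \<in> carrier G" "y \<in> carrier G" for x y
  proof -
    obtain p where p: "geodesic x p y" using geodesic_exists[OF xy] by blast
    note p' = p[unfolded geodesic_def]
    have "x \<otimes> word_elt p \<otimes> word_elt (inv_word p) = x"
      using conjunct1[OF conjunct2[OF p']] xy by (simp add: word_elt_inv_word m_assoc)
    then have "y \<otimes> word_elt (inv_word p) = x" using p' by simp
    then show ?thesis using gdist_le[of y "inv_word p"] p' that by simp
  qed
  then show ?thesis using assms by (simp add: antisym)
qed

lemma gdist_self [simp]: "x \<in> carrier G \<Longrightarrow> gdist x x = 0"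
  using gdist_le[of x "[]"] by simp

lemma gdist_eq_0: "x \<in> carrier G \<Longrightarrow> y \<in> carrier G \<Longrightarrow> gdist x y = 0 \<longleftrightarrow> x = y"
  using geodesic_exists[of x y] by (auto simp: geodesic_def)

lemma geodesic_Nil: "x \<in> carrier G \<Longrightarrow> geodesic x [] x"
  by (simp add: geodesic_def)

lemma geodesic_closed: "geodesic x es y \<Longrightarrow> y \<in> carrier G"
  by (auto simp: geodesic_def)

text \<open>The two parts of the geodesic bound the distances from above, and their lengths add up to
  \<open>gdist x y\<close>, which leaves no slack in the triangle inequality.\<close>

lemma geodesic_vertex:
  assumes "geodesic x es y" "i \<le> length es"
  shows "x \<otimes> word_elt (take i es) \<in> carrier G" "gdist x (x \<otimes> word_elt (take i es)) = i"
    "gdist (x \<otimes> word_elt (take i es)) y = length es - i"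
proof -
  let ?v = "x \<otimes> word_elt (take i es)"
  have x: "x \<in> carrier G" and w: "word es" and y: "x \<otimes> word_elt es = y"
    and len: "length es = gdist x y"
    using assms(1) by (auto simp: geodesic_def)
  have wt: "word (take i es)" and wd: "word (drop i es)"
    using w append_take_drop_id[of i es] word_simps(3)[of "take i es" "drop i es"] by auto
  show v: "?v \<in> carrier G" using x wt by simp
  have "word_elt es = word_elt (take i es) \<otimes> word_elt (drop i es)"
    using word_elt_append[OF wt wd] by simp
  then have "?v \<otimes> word_elt (drop i es) = y" using x wt wd y by (simp add: m_assoc)
  then have "gdist ?v y \<le> length es - i" using gdist_le[OF v wd] by simp
  moreover have "gdist x ?v \<le> i" using gdist_le[OF x wt] assms(2) by simp
  moreover have "gdist x y \<le> gdist x ?v + gdist ?v y"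
    using gdist_triangle x v assms(1) geodesic_closed by blast
  ultimately show "gdist x ?v = i" "gdist ?v y = length es - i" using len assms(2) by auto
qed

lemma path_in_paths_between:
  "(x, es) \<in> paths_between G \<Lambda> H X x y \<longleftrightarrow> x \<in> carrier G \<and> word es \<and> x \<otimes> word_elt es = y"
  by (auto simp: paths_between_def is_path_def path_start_def path_end_def path_length_def
      vertex_eq word_def[symmetric])

lemma cayley_dist_eq:
  assumes "x \<in> carrier G" "y \<in> carrier G"
  shows "cayley_dist G \<Lambda> H X x y = enat (gdist x y)"
proof (rule antisym)
  obtain es where "geodesic x es y" using geodesic_exists assms by blast
  then show "cayley_dist G \<Lambda> H X x y \<le> enat (gdist x y)"
    unfolding cayley_dist_def
    by (intro INF_lower2[of "(x, es)"])
      (auto simp: path_in_paths_between geodesic_def path_length_def)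
  show "enat (gdist x y) \<le> cayley_dist G \<Lambda> H X x y"
    unfolding cayley_dist_def
  proof (rule INF_greatest)
    fix p assume p: "p \<in> paths_between G \<Lambda> H X x y"
    then have "fst p = x" by (simp add: paths_between_def path_start_def)
    then have "p = (x, snd p)" by (cases p) auto
    then show "enat (gdist x y) \<le> enat (path_length p)"
      using p gdist_le[of x "snd p"] path_in_paths_between[of x "snd p" y]
      by (auto simp: path_length_def)
  qed
qed

lemma geodesic_imp_geodesic_path:
  assumes "geodesic x es y"
  shows "geodesic_path G \<Lambda> H X (x, es)" "path_end G (x, es) = y"
  using assms geodesic_closed[OF assms] cayley_dist_eq[of x y]
  by (auto simp: geodesic_path_def geodesic_def is_path_def path_start_def path_end_def
      path_length_def vertex_eq word_def[symmetric])

section \<open>Left cosets and the relative metrics\<close>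

text \<open>The index is kept because different indices may have the same subgroup.\<close>

definition coset :: "'l \<Rightarrow> 'g set \<Rightarrow> bool" where
  "coset l A \<longleftrightarrow> l \<in> \<Lambda> \<and> (\<exists>a\<in>carrier G. A = a <# H l)"

lemma cosetD:
  assumes "coset l A"
  shows coset_index: "l \<in> \<Lambda>" and coset_subset: "A \<subseteq> carrier G" and coset_nonempty: "A \<noteq> {}"
proof -
  obtain a where a: "l \<in> \<Lambda>" "a \<in> carrier G" "A = a <# H l" using assms by (auto simp: coset_def)
  then show "l \<in> \<Lambda>" "A \<subseteq> carrier G" using H_closed by (auto simp: l_coset_def)
  have "a \<otimes> \<one> \<in> A" using a H_one unfolding l_coset_def by blast
  then show "A \<noteq> {}" by blast
qed

lemma coset_mem_iff:
  assumes "coset l A" "x \<in> A"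
  shows "y \<in> A \<longleftrightarrow> y \<in> carrier G \<and> inv x \<otimes> y \<in> H l"
proof -
  have l: "l \<in> \<Lambda>" using assms(1) by (rule coset_index)
  obtain a h where a: "a \<in> carrier G" "A = a <# H l" and h: "h \<in> H l" "x = a \<otimes> h"
    using assms by (auto simp: coset_def l_coset_def)
  note hc = H_closed[OF l h(1)]
  show ?thesis
  proof
    assume "y \<in> A"
    then obtain k where k: "k \<in> H l" "y = a \<otimes> k" using a by (auto simp: l_coset_def)
    have "inv x \<otimes> y = inv h \<otimes> k"
      using a h k hc H_closed[OF l] by (simp add: inv_mult_group m_assoc)
    then show "y \<in> carrier G \<and> inv x \<otimes> y \<in> H l"
      using a k l h H_inv H_mult H_closed by simp
  next
    assume y: "y \<in> carrier G \<and> inv x \<otimes> y \<in> H l"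
    have "y = a \<otimes> (h \<otimes> (inv x \<otimes> y))"
      using a h y hc by (simp add: inv_mult_group m_assoc)
    then show "y \<in> A" using a y l h H_mult by (auto simp: l_coset_def)
  qed
qed

lemma coset_own: "l \<in> \<Lambda> \<Longrightarrow> coset l (H l)"
  unfolding coset_def by (intro conjI bexI[of _ \<one>]) (auto simp: l_coset_def H_closed)

lemma coset_mult:
  assumes "coset l A" "x \<in> A" "h \<in> H l"
  shows "x \<otimes> h \<in> A"
proof -
  have "x \<in> carrier G" "h \<in> carrier G" using assms coset_subset coset_index H_closed by blast+
  then show ?thesis using coset_mem_iff[OF assms(1,2), of "x \<otimes> h"] assms(3) by simp
qed

lemma coset_eqI: "coset l A \<Longrightarrow> coset l B \<Longrightarrow> x \<in> A \<Longrightarrow> x \<in> B \<Longrightarrow> A = B"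
  using coset_mem_iff by blast

lemma coset_eq_l_coset:
  assumes "coset l A" "x \<in> A"
  shows "A = x <# H l"
proof (rule coset_eqI[OF assms(1) _ assms(2)])
  have x: "x \<in> carrier G" using assms coset_subset by blast
  then show "coset l (x <# H l)" using assms(1) by (auto simp: coset_def)
  show "x \<in> x <# H l" using x H_one[OF coset_index[OF assms(1)]] by (force simp: l_coset_def)
qed

lemma coset_translate: "g \<in> carrier G \<Longrightarrow> coset l A \<Longrightarrow> coset l (g <# A)"
  unfolding coset_def using lcos_m_assoc[of "H l" g] H_closed by (metis m_closed subsetI)

lemma translate_mem_iff:
  "g \<in> carrier G \<Longrightarrow> A \<subseteq> carrier G \<Longrightarrow> x \<in> carrier G \<Longrightarrow> g \<otimes> x \<in> g <# A \<longleftrightarrow> x \<in> A"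
  by (auto simp: l_coset_def subset_iff)

lemma gdist_coset:
  assumes "coset l A" "x \<in> A" "y \<in> A"
  shows "gdist x y \<le> 1"
proof (cases "x = y")
  case True
  then show ?thesis using assms coset_subset by fastforce
next
  case False
  let ?h = "inv x \<otimes> y"
  have xy: "x \<in> carrier G" "y \<in> carrier G" using assms coset_subset by blast+
  have "?h \<in> H l" using assms coset_mem_iff by blast
  moreover have "?h \<noteq> \<one>" using False xy by (metis inv_mult_cancel(2) r_one)
  ultimately have "HLetter l ?h \<in> alphabet G \<Lambda> H X"
    using HLetter_in_alphabet assms coset_index by blast
  then show ?thesis
    using gdist_le[of x "[(HLetter l ?h, True)]"] xy by (simp add: step_elt_def)
qed

text \<open>The path reads no \<open>H\<^sub>l\<close>-letter at a vertex of \<open>A\<close>; as \<open>H\<^sub>l\<close>-letters do not leave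
  a left coset of \<open>H\<^sub>l\<close>, it has no \<open>H\<^sub>l\<close>-edge that meets \<open>A\<close>.\<close>

primrec avoids :: "'l \<Rightarrow> 'g set \<Rightarrow> 'g \<Rightarrow> (('g, 'l) letter \<times> bool) list \<Rightarrow> bool" where
  "avoids l A x [] \<longleftrightarrow> True"
| "avoids l A x (s # es) \<longleftrightarrow> \<not> (is_HLetter l (fst s) \<and> x \<in> A) \<and> avoids l A (x \<otimes> step_elt G s) es"

lemma avoids_iff_nth:
  assumes "x \<in> carrier G" "word es"
  shows "avoids l A x es \<longleftrightarrow>
    (\<forall>i<length es. is_HLetter l (fst (es ! i)) \<longrightarrow> x \<otimes> word_elt (take i es) \<notin> A)"
  using assms
proof (induction es arbitrary: x)
  case Nil
  then show ?case by simp
next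
  case (Cons s es)
  have s: "step_elt G s \<in> carrier G" using Cons.prems step_closed by simp
  have "x \<otimes> word_elt (take (Suc i) (s # es)) = x \<otimes> step_elt G s \<otimes> word_elt (take i es)" for i
    using Cons.prems s by (simp add: m_assoc word_take)
  then show ?case
    using Cons s by (auto simp: All_less_Suc2)
qed

lemma avoids_append:
  "x \<in> carrier G \<Longrightarrow> word es \<Longrightarrow>
    avoids l A x (es @ es') \<longleftrightarrow> avoids l A x es \<and> avoids l A (x \<otimes> word_elt es) es'"
  by (induction es arbitrary: x) (auto simp: step_closed m_assoc)

lemma avoids_translate:
  "g \<in> carrier G \<Longrightarrow> A \<subseteq> carrier G \<Longrightarrow> x \<in> carrier G \<Longrightarrow> word es \<Longrightarrow>
    avoids l (g <# A) (g \<otimes> x) es \<longleftrightarrow> avoids l A x es"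
  by (induction es arbitrary: x) (auto simp: step_closed m_assoc translate_mem_iff)

text \<open>The condition inspects the first vertex of each \<open>H\<^sub>l\<close>-edge only; it passes to the reversed path
  because the other vertex of such an edge is in the same coset.\<close>

lemma avoids_inv_word:
  assumes "coset l A" "x \<in> carrier G" "word es" "avoids l A x es"
  shows "avoids l A (x \<otimes> word_elt es) (inv_word es)"
  using assms(2-)
proof (induction es arbitrary: x)
  case Nil
  then show ?case by simp
next
  case (Cons s es)
  let ?y = "x \<otimes> step_elt G s"
  have s: "step_elt G s \<in> carrier G" using Cons.prems step_closed by simp
  have end_at: "x \<otimes> word_elt (s # es) = ?y \<otimes> word_elt es" using Cons.prems s by (simp add: m_assoc)
  have backwards: "?y \<otimes> word_elt es \<otimes> word_elt (inv_word es) = ?y"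
    using Cons.prems s by (simp add: word_elt_inv_word m_assoc)
  have "x \<in> A" if "is_HLetter l (fst s)" "?y \<in> A"
  proof -
    have "fst s \<in> alphabet G \<Lambda> H X" using Cons.prems by simp
    then have "inv (step_elt G s) \<in> H l" using H_letter_step[OF _ that(1)] H_inv by blast
    then have "?y \<otimes> inv (step_elt G s) \<in> A" using coset_mult assms(1) that by blast
    then show ?thesis using s Cons.prems by (simp add: m_assoc)
  qed
  then show ?case
    using Cons s unfolding end_at by (auto simp: avoids_append backwards)
qed

lemma INF_enat_le_iff: "(INF p\<in>S. enat (f p)) \<le> enat n \<longleftrightarrow> (\<exists>p\<in>S. f p \<le> n)"
proof
  assume le: "(INF p\<in>S. enat (f p)) \<le> enat n"
  then have ne: "(\<lambda>p. enat (f p)) ` S \<noteq> {}" by (auto simp: top_enat_def)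
  then have "Inf ((\<lambda>p. enat (f p)) ` S) = (LEAST k. k \<in> (\<lambda>p. enat (f p)) ` S)"
    by (simp add: Inf_enat_def)
  moreover have "(LEAST k. k \<in> (\<lambda>p. enat (f p)) ` S) \<in> (\<lambda>p. enat (f p)) ` S"
    using ne by (metis LeastI equals0I)
  ultimately obtain p where "p \<in> S" "(INF p\<in>S. enat (f p)) = enat (f p)" by auto
  then show "\<exists>p\<in>S. f p \<le> n" using le by auto
next
  assume "\<exists>p\<in>S. f p \<le> n"
  then show "(INF p\<in>S. enat (f p)) \<le> enat n"
    by (metis INF_lower2 enat_ord_simps(1))
qed

text \<open>An edge with an \<open>H\<^sub>l\<close>-letter that starts in \<open>H l\<close> also ends there, so it lies in the complete
  graph on \<open>H l\<close> as soon as its first vertex is in \<open>H l\<close>.\<close>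

lemma rel_dist_le_iff:
  assumes l: "l \<in> \<Lambda>" and h: "h \<in> H l"
  shows "rel_dist G \<Lambda> H X l h k \<le> enat n \<longleftrightarrow>
    (\<exists>es. word es \<and> h \<otimes> word_elt es = k \<and> avoids l (H l) h es \<and> length es \<le> n)"
proof -
  have hc: "h \<in> carrier G" using l h by (rule H_closed)
  have stays: "h \<otimes> word_elt (take (Suc i) es) \<in> H l"
    if "word es" "i < length es" "is_HLetter l (fst (es ! i))" "h \<otimes> word_elt (take i es) \<in> H l"
    for i es
  proof -
    have s: "fst (es ! i) \<in> alphabet G \<Lambda> H X" using that by (simp add: word_def)
    have "h \<otimes> word_elt (take (Suc i) es) = h \<otimes> word_elt (take i es) \<otimes> step_elt G (es ! i)"
      using that s hc by (simp add: take_Suc_conv_app_nth word_elt_append word_take step_closed m_assoc)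
    then show ?thesis using H_mult[OF l that(4)] H_letter_step[OF s that(3)] by simp
  qed
  have "rel_dist G \<Lambda> H X l h k \<le> enat n \<longleftrightarrow>
    (\<exists>p\<in>paths_between G \<Lambda> H X h k.
      (\<forall>i<path_length p. \<not> (is_HLetter l (edge_letter p i) \<and>
          vertex G p i \<in> H l \<and> vertex G p (Suc i) \<in> H l)) \<and> path_length p \<le> n)"
    unfolding rel_dist_def INF_enat_le_iff by blast
  also have "\<dots> \<longleftrightarrow> (\<exists>es. word es \<and> h \<otimes> word_elt es = k \<and>
      (\<forall>i<length es. \<not> (is_HLetter l (fst (es ! i)) \<and> h \<otimes> word_elt (take i es) \<in> H l \<and>
        h \<otimes> word_elt (take (Suc i) es) \<in> H l)) \<and> length es \<le> n)" (is "?L \<longleftrightarrow> ?R")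
  proof
    assume ?L
    then obtain p where p: "p \<in> paths_between G \<Lambda> H X h k" "path_length p \<le> n"
      "\<forall>i<path_length p. \<not> (is_HLetter l (edge_letter p i) \<and>
          vertex G p i \<in> H l \<and> vertex G p (Suc i) \<in> H l)" by blast
    then have eq: "p = (h, snd p)" by (cases p) (simp add: paths_between_def path_start_def)
    then have "word (snd p)" "h \<otimes> word_elt (snd p) = k" using p path_in_paths_between by metis+
    moreover have "vertex G p i = h \<otimes> word_elt (take i (snd p))" for i
      using vertex_eq[OF \<open>word (snd p)\<close> hc] eq by metis
    ultimately show ?R
      using p(2,3) by (intro exI[of _ "snd p"]) (simp add: path_length_def edge_letter_def)
  next
    assume ?R
    then obtain es where es: "word es" "h \<otimes> word_elt es = k" "length es \<le> n"
      "\<forall>i<length es. \<not> (is_HLetter l (fst (es ! i)) \<and> h \<otimes> word_elt (take i es) \<in> H l \<and>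
        h \<otimes> word_elt (take (Suc i) es) \<in> H l)" by blast
    then show ?L using hc
      by (intro bexI[of _ "(h, es)"])
        (simp_all add: path_in_paths_between path_length_def edge_letter_def vertex_eq)
  qed
  also have "\<dots> \<longleftrightarrow> (\<exists>es. word es \<and> h \<otimes> word_elt es = k \<and> avoids l (H l) h es \<and> length es \<le> n)"
  proof -
    have "(\<forall>i<length es. \<not> (is_HLetter l (fst (es ! i)) \<and> h \<otimes> word_elt (take i es) \<in> H l \<and>
        h \<otimes> word_elt (take (Suc i) es) \<in> H l)) \<longleftrightarrow> avoids l (H l) h es" if "word es" for es
      unfolding avoids_iff_nth[OF hc that] using stays[OF that] by blast
    then show ?thesis by blast
  qed
  finally show ?thesis .
qed

text \<open>Relative distance at most \<open>r\<close>. The distance itself may be infinite, so it is used only through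
  such comparisons.\<close>

definition near :: "'l \<Rightarrow> real \<Rightarrow> 'g \<Rightarrow> 'g \<Rightarrow> bool" where
  "near l r a b \<longleftrightarrow> ereal_of_enat (rel_dist_ext G \<Lambda> H X l a b) \<le> ereal r"

text \<open>The paths in the relative distance run from \<open>a\<^sup>-\<^sup>1 b\<close> to \<open>1\<close>; translated by \<open>a\<close> they run from \<open>b\<close>
  to \<open>a\<close> and avoid the coset of \<open>a\<close>. In this form they can be concatenated and reversed.\<close>

lemma near_iff:
  assumes l: "l \<in> \<Lambda>" and a: "a \<in> carrier G" and b: "b \<in> carrier G"
  shows "near l r a b \<longleftrightarrow> inv a \<otimes> b \<in> H l \<and>
    (\<exists>es. word es \<and> b \<otimes> word_elt es = a \<and> avoids l (a <# H l) b es \<and> real (length es) \<le> r)"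
proof (cases "inv a \<otimes> b \<in> H l")
  case False
  then show ?thesis by (simp add: near_def rel_dist_ext_def)
next
  case True
  let ?h = "inv a \<otimes> b"
  have le: "ereal_of_enat d \<le> ereal r \<longleftrightarrow> (\<exists>n. d \<le> enat n \<and> real n \<le> r)" for d
    by (cases d) (auto intro: order_trans[of _ "real _"])
  have "near l r a b \<longleftrightarrow> (\<exists>n. rel_dist G \<Lambda> H X l ?h \<one> \<le> enat n \<and> real n \<le> r)"
    using True by (simp add: near_def rel_dist_ext_def le)
  also have "\<dots> \<longleftrightarrow> (\<exists>es. word es \<and> ?h \<otimes> word_elt es = \<one> \<and> avoids l (H l) ?h es \<and> real (length es) \<le> r)"
    unfolding rel_dist_le_iff[OF l True] by (meson of_nat_le_iff order_refl order_trans)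
  also have "\<dots> \<longleftrightarrow> (\<exists>es. word es \<and> b \<otimes> word_elt es = a \<and> avoids l (a <# H l) b es \<and> real (length es) \<le> r)"
  proof -
    have "avoids l (a <# H l) b es \<longleftrightarrow> avoids l (H l) ?h es" if "word es" for es
      using avoids_translate[of a "H l" ?h es l] that a b H_closed[OF l] by (simp add: subset_iff)
    moreover have "?h \<otimes> word_elt es = \<one> \<longleftrightarrow> b \<otimes> word_elt es = a" if "word es" for es
      using that a b by (simp add: m_assoc) (metis inv_mult_cancel l_inv m_closed r_one word_elt_closed)
    ultimately show ?thesis by blast
  qed
  finally show ?thesis using True by simp
qed

lemma near_refl:
  assumes "l \<in> \<Lambda>" "a \<in> carrier G" "0 \<le> r"
  shows "near l r a a"
proof -
  have "word [] \<and> a \<otimes> word_elt [] = a \<and> avoids l (a <# H l) a [] \<and> real (length []) \<le> r"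
    using assms by simp
  then show ?thesis unfolding near_iff[OF assms(1,2,2)] using assms H_one[of l] by (metis l_inv)
qed

lemma near_mono: "near l r a b \<Longrightarrow> r \<le> s \<Longrightarrow> near l s a b"
  unfolding near_def by (meson ereal_less_eq(3) order_trans)

lemma l_coset_eq:
  assumes "l \<in> \<Lambda>" "a \<in> carrier G" "b \<in> carrier G" "inv a \<otimes> b \<in> H l"
  shows "a <# H l = b <# H l"
proof -
  have "coset l (a <# H l)" using assms by (auto simp: coset_def)
  moreover have "b \<in> a <# H l" using assms by (force simp: l_coset_def)
  ultimately show ?thesis by (rule coset_eq_l_coset)
qed

lemma near_sym:
  assumes l: "l \<in> \<Lambda>" and a: "a \<in> carrier G" and b: "b \<in> carrier G" and "near l r a b"
  shows "near l r b a"
proof -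
  obtain es where h: "inv a \<otimes> b \<in> H l" and es: "word es" "b \<otimes> word_elt es = a"
    "avoids l (a <# H l) b es" "real (length es) \<le> r"
    using near_iff[OF l a b] assms(4) by blast
  have "coset l (a <# H l)" using l a by (auto simp: coset_def)
  then have "avoids l (b <# H l) a (inv_word es)"
    using avoids_inv_word[OF _ b es(1)] es l_coset_eq[OF l a b h] by simp
  moreover have "b \<otimes> word_elt es \<otimes> word_elt (inv_word es) = b"
    using es(1) b by (simp add: word_elt_inv_word m_assoc)
  moreover have "inv b \<otimes> a \<in> H l" using H_inv[OF l h] a b by (simp add: inv_mult_group)
  ultimately show ?thesis using es unfolding near_iff[OF l b a]
    by (intro conjI exI[of _ "inv_word es"]) auto
qed

lemma near_trans:
  assumes l: "l \<in> \<Lambda>" and a: "a \<in> carrier G" and b: "b \<in> carrier G" and c: "c \<in> carrier G"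
    and ab: "near l r a b" and bc: "near l s b c"
  shows "near l (r + s) a c"
proof -
  obtain p where h: "inv a \<otimes> b \<in> H l" and p: "word p" "b \<otimes> word_elt p = a"
    "avoids l (a <# H l) b p" "real (length p) \<le> r"
    using near_iff[OF l a b] ab by blast
  obtain q where k: "inv b \<otimes> c \<in> H l" and q: "word q" "c \<otimes> word_elt q = b"
    "avoids l (b <# H l) c q" "real (length q) \<le> s"
    using near_iff[OF l b c] bc by blast
  have "inv a \<otimes> c = (inv a \<otimes> b) \<otimes> (inv b \<otimes> c)" using a b c by (simp add: m_assoc)
  then have "inv a \<otimes> c \<in> H l" using H_mult[OF l h k] by simp
  moreover have "c \<otimes> word_elt (q @ p) = c \<otimes> word_elt q \<otimes> word_elt p"
    using c p(1) q(1) by (simp add: word_elt_append m_assoc)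
  moreover have "avoids l (a <# H l) c (q @ p)"
    using p q c l_coset_eq[OF l a b h] by (simp add: avoids_append)
  ultimately show ?thesis using p q unfolding near_iff[OF l a c]
    by (intro conjI exI[of _ "q @ p"]) auto
qed

lemma near_translate:
  "g \<in> carrier G \<Longrightarrow> a \<in> carrier G \<Longrightarrow> b \<in> carrier G \<Longrightarrow>
    near l r (g \<otimes> a) (g \<otimes> b) \<longleftrightarrow> near l r a b"
  by (simp add: near_def rel_dist_ext_def inv_mult_group m_assoc)

lemma finite_near:
  assumes l: "l \<in> \<Lambda>" and a: "a \<in> carrier G"
  shows "finite {b \<in> carrier G. near l r a b}"
proof (rule finite_subset)
  let ?B = "{k \<in> H l. rel_dist G \<Lambda> H X l \<one> k \<le> enat (nat \<lfloor>r\<rfloor>)}"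
  show "finite ((\<lambda>h. a \<otimes> h) ` ?B)"
    using embedded l H_one[OF l] by (simp add: hyp_embedded_wrt_def)
  show "{b \<in> carrier G. near l r a b} \<subseteq> (\<lambda>h. a \<otimes> h) ` ?B"
  proof
    fix b assume "b \<in> {b \<in> carrier G. near l r a b}"
    then have b: "b \<in> carrier G" and "near l r (a \<otimes> \<one>) (a \<otimes> (inv a \<otimes> b))" using a by simp_all
    then have n: "near l r \<one> (inv a \<otimes> b)" using near_translate[of a \<one> "inv a \<otimes> b"] a by simp
    let ?h = "inv a \<otimes> b"
    have hc: "?h \<in> carrier G" using a b by simp
    have "near l r ?h \<one>" using near_sym[OF l _ hc n] by simp
    then obtain es where es: "inv ?h \<otimes> \<one> \<in> H l" "word es" "\<one> \<otimes> word_elt es = ?h"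
      "avoids l (?h <# H l) \<one> es" "real (length es) \<le> r"
      using near_iff[OF l hc one_closed] by blast
    have "inv (inv ?h \<otimes> \<one>) \<in> H l" using H_inv[OF l es(1)] .
    then have hH: "?h \<in> H l" using hc by (simp del: inv_mult_group)
    then have "?h <# H l = H l" using coset_eq_l_coset[OF coset_own[OF l]] by simp
    moreover have "length es \<le> nat \<lfloor>r\<rfloor>" using es(5) by (simp add: le_nat_floor)
    ultimately have "rel_dist G \<Lambda> H X l \<one> ?h \<le> enat (nat \<lfloor>r\<rfloor>)"
      unfolding rel_dist_le_iff[OF l H_one[OF l]] using es hc by (intro exI[of _ es]) simp
    then show "b \<in> (\<lambda>h. a \<otimes> h) ` ?B"
      using hH a b by (intro image_eqI[of _ _ ?h]) simp_all
  qed
qed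

section \<open>Nearest points, and geodesics that cross a coset\<close>

text \<open>This is where the bound on isolated components enters. Closing the four geodesics up by the
  single \<open>H\<^sub>l\<close>-edge from \<open>u\<close> to \<open>v\<close> gives a geodesic pentagon, in which this edge is an isolated
  component because no other \<open>H\<^sub>l\<close>-edge meets \<open>A\<close>. Sides may be trivial, so triangles and
  quadrangles are covered as well.\<close>

lemma near_if_sides_avoid:
  assumes A: "coset l A" and u: "u \<in> A" and v: "v \<in> A"
    and p: "geodesic v p1 x" "geodesic x p2 y" "geodesic y p3 z" "geodesic z p4 u"
    and av: "avoids l A v p1" "avoids l A x p2" "avoids l A y p3" "avoids l A z p4"
  shows "near l (5 * C) u v"
proof (cases "u = v")
  case True
  moreover have "u \<in> carrier G" using A u coset_subset by blast
  ultimately show ?thesis using near_refl[OF coset_index[OF A]] C_pos by simp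
next
  case False
  note l = coset_index[OF A]
  have uc: "u \<in> carrier G" and vc: "v \<in> carrier G" using A u v coset_subset by blast+
  let ?h = "inv u \<otimes> v"
  have h: "?h \<in> H l" using A u v coset_mem_iff by blast
  have h1: "?h \<noteq> \<one>" using False uc vc by (metis inv_mult_cancel(2) r_one)
  define e :: "('g, 'l) letter \<times> bool" where "e = (HLetter l ?h, True)"
  have e: "fst e \<in> alphabet G \<Lambda> H X" "step_elt G e = ?h" "is_HLetter l (fst e)"
    using HLetter_in_alphabet[OF l h h1] by (simp_all add: e_def step_elt_def)
  have "gdist u v = 1"
    using gdist_coset[OF A u v] gdist_eq_0[OF uc vc] False by linarith
  then have ge: "geodesic u [e] v" using e uc vc by (simp add: geodesic_def)
  define w where "w = p1 @ p2 @ p3 @ p4"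
  note gs = p[unfolded geodesic_def]
  have ww: "word w" using gs by (simp add: w_def)
  have xc: "x \<in> carrier G" "y \<in> carrier G" "z \<in> carrier G" using gs by simp_all
  have wu: "v \<otimes> word_elt w = u"
    using gs vc by (simp add: w_def word_elt_append flip: m_assoc)
  have avw: "avoids l A v w" using av gs vc xc by (simp add: w_def avoids_append)
  have wne: "w \<noteq> []" using wu False vc by auto
  let ?p = "(u, e # w)" and ?ps = "[(u, [e]), (v, p1), (x, p2), (y, p3), (z, p4)]"
  let ?L = "path_length ?p"
  have L: "?L = Suc (length w)" by (simp add: path_length_def)
  have vtx: "vertex G ?p j = u \<otimes> word_elt (take j (e # w))" for j
    using vertex_eq[of "e # w" u j] e ww uc by simp
  have vtx0: "vertex G ?p 0 = u" using vtx[of 0] uc by simp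
  have vtx_Suc: "vertex G ?p (Suc j) = v \<otimes> word_elt (take j w)" for j
    using vtx[of "Suc j"] e uc vc ww by (simp add: word_take flip: m_assoc)
  have ngon: "geodesic_ngon G \<Lambda> H X 5 ?p"
    unfolding geodesic_ngon_def
  proof (intro exI[of _ ?ps] conjI allI impI)
    show "\<forall>s\<in>set ?ps. geodesic_path G \<Lambda> H X s"
      using geodesic_imp_geodesic_path(1) ge p by auto
    fix i :: nat assume "i < 5"
    then consider "i = 0" | "i = 1" | "i = 2" | "i = 3" | "i = 4" by linarith
    then show "path_end G (?ps ! i) = path_start (?ps ! (Suc i mod 5))"
      using geodesic_imp_geodesic_path(2)[OF ge] geodesic_imp_geodesic_path(2)[OF p(1)]
        geodesic_imp_geodesic_path(2)[OF p(2)] geodesic_imp_geodesic_path(2)[OF p(3)]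
        geodesic_imp_geodesic_path(2)[OF p(4)]
      by cases (simp_all add: path_start_def)
  qed (simp_all add: path_start_def w_def)
  have off: "vertex G ?p j \<notin> A" if j: "0 < j" "j < ?L" "is_HLetter l (edge_letter ?p j)" for j
  proof -
    obtain i where i: "j = Suc i" using j(1) gr0_implies_Suc by blast
    then show ?thesis using j avw avoids_iff_nth[OF vc ww, of l A] vtx_Suc[of i]
      by (simp add: L edge_letter_def)
  qed
  \<comment> \<open>The inserted edge is not part of a longer arc of \<open>H\<^sub>l\<close>-letters: both of its neighbours in the
    cyclic order have a vertex in common with it, which is in \<open>A\<close>.\<close>
  have not1: "\<not> is_HLetter l (edge_letter ?p 1)"
    using off[of 1] vtx_Suc[of 0] v vc wne L by auto
  have notlast: "\<not> is_HLetter l (edge_letter ?p (?L - 1))"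
  proof
    assume is_H: "is_HLetter l (edge_letter ?p (?L - 1))"
    define s where "s = last w"
    have w_eq: "w = butlast w @ [s]" using wne by (simp add: s_def)
    have s: "is_HLetter l (fst s)" "fst s \<in> alphabet G \<Lambda> H X" and wb: "word (butlast w)"
      using is_H wne ww w_eq
      by (simp_all add: edge_letter_def L s_def last_conv_nth nth_Cons' word_def in_set_butlastD)
    have vl: "vertex G ?p (?L - 1) = v \<otimes> word_elt (butlast w)"
      using vtx_Suc[of "length w - 1"] wne by (simp add: L butlast_conv_take)
    have "u = v \<otimes> word_elt (butlast w @ [s])" using wu w_eq by simp
    then have "u = v \<otimes> word_elt (butlast w) \<otimes> step_elt G s"
      using s wb vc by (simp add: word_elt_append step_closed m_assoc)
    then have "v \<otimes> word_elt (butlast w) = u \<otimes> inv (step_elt G s)"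
      using wb vc s by (simp add: m_assoc step_closed)
    moreover have "u \<otimes> inv (step_elt G s) \<in> A"
      using coset_mult[OF A u] H_inv[OF l] H_letter_step[OF s(2,1)] by simp
    ultimately show False using off[of "?L - 1"] is_H vl wne by (simp add: L)
  qed
  have arc0: "arc_edges ?p 0 1 = {0}" by (auto simp: arc_edges_def L)
  have comp: "loop_component l ?p 0 1"
    unfolding loop_component_def
  proof (intro conjI notI)
    show "H_arc l ?p 0 1" using e unfolding H_arc_def arc0 by (simp add: edge_letter_def L)
    assume "\<exists>i' m'. H_arc l ?p i' m' \<and> arc_edges ?p 0 1 \<subset> arc_edges ?p i' m'"
    then obtain i m where H: "H_arc l ?p i m" and sub: "{0} \<subset> arc_edges ?p i m"
      unfolding arc0 by blast
    have inarc: "is_HLetter l (edge_letter ?p ((i + k) mod ?L))" if "k < m" for k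
      using H that by (auto simp: H_arc_def arc_edges_def)
    have "0 \<in> arc_edges ?p i m" using sub by blast
    then obtain k where k: "k < m" "(i + k) mod ?L = 0" unfolding arc_edges_def by fastforce
    have "m \<noteq> 1"
    proof
      assume m: "m = 1"
      then have "k = 0" using k by simp
      then have "arc_edges ?p i m = {0}" unfolding arc_edges_def m using k by fastforce
      then show False using sub by blast
    qed
    then consider "k + 1 < m" | "k \<ge> 1" using k by linarith
    then show False
    proof cases
      case 1
      have "(i + (k + 1)) mod ?L = 1"
        using k(2) wne by (simp add: L mod_Suc)
      then show ?thesis using inarc[OF 1] not1 by simp
    next
      case 2
      have "(Suc (i + (k - 1))) mod ?L = 0" using k(2) 2 by simp
      then have "(i + (k - 1)) mod ?L = ?L - 1"
        by (simp add: mod_Suc split: if_splits)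
      then show ?thesis using inarc[of "k - 1"] notlast k 2 by simp
    qed
  qed
  have iso: "isolated_component G H l ?p 0 1"
    unfolding isolated_component_def
  proof (intro conjI allI impI notI comp)
    fix i m
    assume im: "loop_component l ?p i m \<and> arc_edges ?p i m \<noteq> arc_edges ?p 0 1"
      and conn: "connected_arcs G (H l) ?p 0 1 i m"
    have Harc: "H_arc l ?p i m" using im by (simp add: loop_component_def)
    then have "0 < m" by (simp add: H_arc_def)
    then have "arc_edges ?p i m \<noteq> {}" unfolding arc_edges_def by auto
    then have "\<exists>j. j \<in> arc_edges ?p i m \<and> j \<noteq> 0" using im arc0 by auto
    then obtain j where j: "j \<in> arc_edges ?p i m" "j \<noteq> 0" by (elim exE conjE)
    obtain k where k: "k < m" "j = (i + k) mod ?L"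
      using j(1) unfolding arc_edges_def by (elim imageE) simp
    have "j < ?L" using k L by simp
    moreover have "is_HLetter l (edge_letter ?p j)" using Harc j by (auto simp: H_arc_def)
    ultimately have "vertex G ?p j \<notin> A" using off j by simp
    moreover obtain c where c: "c \<in> carrier G"
      "arc_vertices G ?p 0 1 \<union> arc_vertices G ?p i m \<subseteq> c <# H l"
      using conn by (auto simp: connected_arcs_def)
    have "u \<in> arc_vertices G ?p 0 1"
      unfolding arc_vertices_def using vtx0 by (intro image_eqI[of _ _ 0]) (simp_all add: L)
    moreover have "vertex G ?p j \<in> arc_vertices G ?p i m"
      unfolding arc_vertices_def k(2) using k(1) by (intro image_eqI[of _ _ k]) simp_all
    ultimately have "u \<in> c <# H l" "vertex G ?p j \<in> c <# H l" "vertex G ?p j \<notin> A"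
      using c(2) by blast+
    moreover have "coset l (c <# H l)" using c l by (auto simp: coset_def)
    ultimately show False using coset_eqI[OF A _ u] by blast
  qed
  have "(0 + 1) mod ?L = Suc 0" using wne by (simp add: L)
  moreover have "ereal_of_enat (rel_dist_ext G \<Lambda> H X l (vertex G ?p 0)
      (vertex G ?p ((0 + 1) mod ?L))) \<le> ereal (C * real 5)"
    using polygons ngon iso l unfolding polygon_constant_def by blast
  ultimately show ?thesis
    using vtx0 vtx_Suc[of 0] vc by (simp add: near_def mult.commute)
qed

definition gdist_to :: "'g \<Rightarrow> 'g set \<Rightarrow> nat" where
  "gdist_to x A = (LEAST n. \<exists>a\<in>A. gdist x a = n)"

definition nearest :: "'g \<Rightarrow> 'g set \<Rightarrow> 'g set" where
  "nearest x A = {a \<in> A. gdist x a = gdist_to x A}"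

lemma gdist_to_le: "a \<in> A \<Longrightarrow> gdist_to x A \<le> gdist x a"
  unfolding gdist_to_def by (rule Least_le) blast

lemma nearest_nonempty:
  assumes "A \<noteq> {}"
  shows "nearest x A \<noteq> {}"
proof -
  have "\<exists>n. \<exists>a\<in>A. gdist x a = n" using assms by blast
  then have "\<exists>a\<in>A. gdist x a = gdist_to x A"
    unfolding gdist_to_def by (rule LeastI_ex)
  then show ?thesis by (auto simp: nearest_def)
qed

lemma nearest_subset: "nearest x A \<subseteq> A"
  by (auto simp: nearest_def)

lemma geodesic_inv_word:
  assumes "geodesic x es y"
  shows "geodesic y (inv_word es) x"
proof -
  have x: "x \<in> carrier G" and es: "word es" "x \<otimes> word_elt es = y" "length es = gdist x y"
    using assms by (simp_all add: geodesic_def)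
  have "x \<otimes> word_elt es \<otimes> word_elt (inv_word es) = x"
    using x es(1) by (simp add: word_elt_inv_word m_assoc)
  then show ?thesis
    using es geodesic_closed[OF assms] gdist_commute[of x y] x by (simp add: geodesic_def)
qed

lemma geodesic_to_nearest_avoids:
  assumes "coset l A" "a \<in> nearest x A" "geodesic x es a"
  shows "avoids l A x es"
proof -
  have es: "x \<in> carrier G" "word es" "length es = gdist_to x A"
    using assms by (auto simp: geodesic_def nearest_def)
  have "x \<otimes> word_elt (take i es) \<notin> A" if "i < length es" for i
    using geodesic_vertex(2)[OF assms(3), of i] gdist_to_le[of "x \<otimes> word_elt (take i es)" A x] es that
    by auto
  then show ?thesis using avoids_iff_nth es by blast
qed

text \<open>Every geodesic is required to meet \<open>A\<close> along an \<open>H\<^sub>l\<close>-edge, so that a failure provides a geodesic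
  that can serve as a side of a polygon.\<close>

definition crosses :: "'l \<Rightarrow> 'g set \<Rightarrow> 'g \<Rightarrow> 'g \<Rightarrow> bool" where
  "crosses l A x y \<longleftrightarrow> (\<forall>es. geodesic x es y \<longrightarrow> \<not> avoids l A x es)"

lemma not_crosses_self: "x \<in> carrier G \<Longrightarrow> \<not> crosses l A x x"
  unfolding crosses_def using geodesic_Nil by fastforce

text \<open>The pentagon has the corners \<open>b\<close>, \<open>a\<close>, \<open>x\<close>, \<open>z\<close>, \<open>y\<close>: geodesics to a nearest point avoid \<open>A\<close>
  because they reach \<open>A\<close> only at their last vertex.\<close>

lemma near_if_not_crosses:
  assumes A: "coset l A" and x: "x \<in> carrier G" and y: "y \<in> carrier G"
    and a: "a \<in> nearest x A" and b: "b \<in> nearest y A"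
    and "\<not> crosses l A x z" "\<not> crosses l A z y"
  shows "near l (5 * C) a b"
proof -
  have aA: "a \<in> A" and bA: "b \<in> A" using a b nearest_subset by blast+
  then have ac: "a \<in> carrier G" and bc: "b \<in> carrier G" using A coset_subset by blast+
  obtain p where p: "geodesic x p a" using geodesic_exists x ac by blast
  obtain q where q: "geodesic x q z" "avoids l A x q" using assms(6) by (auto simp: crosses_def)
  obtain r where r: "geodesic z r y" "avoids l A z r" using assms(7) by (auto simp: crosses_def)
  obtain s where s: "geodesic y s b" using geodesic_exists y bc by blast
  have pa: "avoids l A x p" using geodesic_to_nearest_avoids[OF A a p] .
  have p': "word p" "x \<otimes> word_elt p = a" using p by (simp_all add: geodesic_def)
  have "avoids l A a (inv_word p)" using avoids_inv_word[OF A x p'(1) pa] p'(2) by simp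
  then have "near l (5 * C) b a"
    using near_if_sides_avoid[OF A bA aA geodesic_inv_word[OF p] q(1) r(1) s] q r
      geodesic_to_nearest_avoids[OF A b s] by blast
  then show ?thesis using near_sym coset_index[OF A] ac bc by blast
qed

text \<open>An \<open>H\<^sub>l\<close>-edge of a geodesic from \<open>x\<close> to \<open>y\<close> that lies in \<open>A\<close> is as close to \<open>x\<close> and to \<open>y\<close> as
  \<open>A\<close> allows: a detour through nearest points costs at most the one edge between them.\<close>

lemma crosses_edge:
  assumes A: "coset l A" and cr: "crosses l A x y" and g: "geodesic x es y"
  shows "gdist x y = gdist_to x A + 1 + gdist_to y A"
    and "is_HLetter l (fst (es ! gdist_to x A))"
    and "x \<otimes> word_elt (take (gdist_to x A) es) \<in> A"
    and "gdist_to x A < length es"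
proof -
  have x: "x \<in> carrier G" and y: "y \<in> carrier G" and w: "word es" and len: "length es = gdist x y"
    using g geodesic_closed by (auto simp: geodesic_def)
  have "\<not> avoids l A x es" using cr g by (auto simp: crosses_def)
  then obtain i where i: "i < length es" "is_HLetter l (fst (es ! i))" "x \<otimes> word_elt (take i es) \<in> A"
    using avoids_iff_nth[OF x w] by blast
  let ?v = "x \<otimes> word_elt (take (Suc i) es)"
  have s: "fst (es ! i) \<in> alphabet G \<Lambda> H X" using w i by (simp add: word_def)
  have "?v = x \<otimes> word_elt (take i es) \<otimes> step_elt G (es ! i)"
    using i s x w by (simp add: take_Suc_conv_app_nth word_elt_append word_take step_closed m_assoc)
  then have "?v \<in> A" using coset_mult[OF A i(3)] H_letter_step[OF s i(2)] by simp
  moreover have "gdist ?v y = length es - Suc i" "?v \<in> carrier G"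
    using geodesic_vertex[OF g, of "Suc i"] i by auto
  ultimately have yv: "gdist_to y A \<le> length es - Suc i"
    using gdist_to_le[of ?v A y] gdist_commute[of ?v y] y by simp
  have xi: "gdist_to x A \<le> i"
    using geodesic_vertex(2)[OF g, of i] gdist_to_le[OF i(3), of x] i(1) by simp
  obtain a where a: "a \<in> nearest x A" using nearest_nonempty coset_nonempty[OF A] by blast
  obtain b where b: "b \<in> nearest y A" using nearest_nonempty coset_nonempty[OF A] by blast
  have ab: "a \<in> A" "b \<in> A" using a b nearest_subset by blast+
  then have abc: "a \<in> carrier G" "b \<in> carrier G" using A coset_subset by blast+
  have "gdist x y \<le> gdist x a + gdist a b + gdist y b"
    using gdist_triangle[of x a y] gdist_triangle[of a b y] gdist_commute[of b y] x y abc by simp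
  then have "gdist x y \<le> gdist_to x A + 1 + gdist_to y A"
    using gdist_coset[OF A ab] a b by (simp add: nearest_def)
  then have "i = gdist_to x A" "gdist x y = gdist_to x A + 1 + gdist_to y A"
    using yv xi len i(1) by linarith+
  then show "gdist x y = gdist_to x A + 1 + gdist_to y A"
    "is_HLetter l (fst (es ! gdist_to x A))"
    "x \<otimes> word_elt (take (gdist_to x A) es) \<in> A" "gdist_to x A < length es"
    using i by simp_all
qed

lemma gdist_if_crosses:
  assumes "coset l A" "x \<in> carrier G" "y \<in> carrier G" "crosses l A x y"
  shows "gdist x y = gdist_to x A + 1 + gdist_to y A"
  using crosses_edge(1) geodesic_exists assms by blast

text \<open>On a fixed geodesic from \<open>x\<close> to \<open>y\<close>, the distance of \<open>x\<close> to a crossed coset is the position of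
  the edge in that coset, and this edge tells the index by its letter and the coset by its vertices.\<close>

lemma crossed_coset_determined:
  assumes "coset l A" "coset k B" "x \<in> carrier G" "y \<in> carrier G"
    and "crosses l A x y" "crosses k B x y" "gdist_to x A = gdist_to x B"
  shows "l = k" "A = B"
proof -
  obtain es where g: "geodesic x es y" using geodesic_exists assms by blast
  note e1 = crosses_edge[OF assms(1,5) g] and e2 = crosses_edge[OF assms(2,6) g]
  have unique: "l = k" if "is_HLetter l a" "is_HLetter k a" for l k :: 'l and a :: "('g, 'l) letter"
    using that by (cases a) auto
  show "l = k" using unique e1(2) e2(2) assms(7) by metis
  then show "A = B" using e1(3) e2(3) assms(1,2,7) coset_eqI by metis
qed

lemma finite_crossed:
  assumes "x \<in> carrier G" "y \<in> carrier G"
  shows "finite {(l, A). coset l A \<and> crosses l A x y}"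
proof (rule inj_on_finite)
  show "inj_on (\<lambda>(l, A). gdist_to x A) {(l, A). coset l A \<and> crosses l A x y}"
    using crossed_coset_determined assms by (fastforce intro: inj_onI)
  show "(\<lambda>(l, A). gdist_to x A) ` {(l, A). coset l A \<and> crosses l A x y} \<subseteq> {..gdist x y}"
    using gdist_if_crosses assms by fastforce
qed simp

section \<open>Cosets that separate two points\<close>

definition far :: "'l \<Rightarrow> 'g set \<Rightarrow> real \<Rightarrow> 'g \<Rightarrow> 'g \<Rightarrow> bool" where
  "far l A r x y \<longleftrightarrow> (\<exists>a\<in>nearest x A. \<exists>b\<in>nearest y A. \<not> near l r a b)"

lemma nearest_closed: "coset l A \<Longrightarrow> a \<in> nearest x A \<Longrightarrow> a \<in> carrier G"
  using nearest_subset coset_subset by blast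

lemma far_sym: "coset l A \<Longrightarrow> far l A r x y \<Longrightarrow> far l A r y x"
  unfolding far_def using near_sym nearest_closed coset_index by meson

lemma far_sym_iff: "coset l A \<Longrightarrow> far l A r x y \<longleftrightarrow> far l A r y x"
  using far_sym by blast

lemma far_mono: "far l A s x y \<Longrightarrow> r \<le> s \<Longrightarrow> far l A r x y"
  unfolding far_def using near_mono by blast

lemma far_split:
  assumes A: "coset l A" and "far l A (r + s) x y"
  shows "far l A r x z \<or> far l A s z y"
proof -
  obtain a b where a: "a \<in> nearest x A" and b: "b \<in> nearest y A" and ab: "\<not> near l (r + s) a b"
    using assms(2) by (auto simp: far_def)
  obtain c where c: "c \<in> nearest z A" using nearest_nonempty coset_nonempty[OF A] by blast
  have "\<not> near l r a c \<or> \<not> near l s c b"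
    using near_trans[OF coset_index[OF A] nearest_closed[OF A a] nearest_closed[OF A c]
        nearest_closed[OF A b]] ab by blast
  then show ?thesis using a b c by (auto simp: far_def)
qed

text \<open>Geodesics from \<open>x\<close> to \<open>z\<close> and from \<open>z\<close> to \<open>y\<close> that both avoid \<open>A\<close> would be sides of a pentagon and
  would bring the projections of \<open>x\<close> and \<open>y\<close> within \<open>5 C\<close> of each other. The case \<open>z = x\<close> is that
  of a single geodesic from \<open>x\<close> to \<open>y\<close>.\<close>

lemma far_imp_crosses_either:
  assumes "coset l A" "x \<in> carrier G" "y \<in> carrier G" "far l A (5 * C) x y"
  shows "crosses l A x z \<or> crosses l A z y"
  using near_if_not_crosses[OF assms(1-3)] assms(4) unfolding far_def by blast

lemma far_imp_crosses:
  assumes "coset l A" "x \<in> carrier G" "y \<in> carrier G" "far l A (5 * C) x y"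
  shows "crosses l A x y"
  using far_imp_crosses_either[OF assms, of x] not_crosses_self assms(2) by blast

lemma near_nearest:
  assumes "coset l A" "x \<in> carrier G" "a \<in> nearest x A" "b \<in> nearest x A"
  shows "near l (5 * C) a b"
  using near_if_not_crosses[OF assms(1,2,2,3,4)] not_crosses_self assms(2) by blast

lemma finite_nearest:
  assumes A: "coset l A" and x: "x \<in> carrier G"
  shows "finite (nearest x A)"
proof -
  obtain a where a: "a \<in> nearest x A" using nearest_nonempty coset_nonempty[OF A] by blast
  have "nearest x A \<subseteq> {b \<in> carrier G. near l (5 * C) a b}"
    using near_nearest[OF A x a] nearest_closed[OF A] by blast
  then show ?thesis
    using finite_near[OF coset_index[OF A] nearest_closed[OF A a]] finite_subset by blast
qed

text \<open>Suppose geodesics from \<open>x\<close> branch towards \<open>y\<close> and \<open>z\<close> only after two cosets \<open>A\<close> and \<open>B\<close>, met in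
  this order. A point \<open>a\<close> of \<open>A\<close> nearest to \<open>y\<close> lies on a geodesic from \<open>x\<close> to \<open>y\<close>, which has
  yet to cross \<open>B\<close> after \<open>a\<close>; beyond \<open>B\<close> it can be redirected to \<open>z\<close> and remains geodesic, so \<open>a\<close> is
  also nearest to \<open>z\<close>.\<close>

lemma nearest_subset_before_branching:
  assumes A: "coset l A" and B: "coset k B"
    and x: "x \<in> carrier G" and y: "y \<in> carrier G" and z: "z \<in> carrier G"
    and Ay: "crosses l A x y" and Az: "crosses l A x z"
    and By: "far k B (5 * C) x y" and Bz: "crosses k B x z"
    and before: "gdist_to x A < gdist_to x B"
  shows "nearest y A \<subseteq> nearest z A"
proof
  fix a assume a: "a \<in> nearest y A"
  then have aA: "a \<in> A" and ac: "a \<in> carrier G" and ya: "gdist y a = gdist_to y A"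
    using nearest_subset nearest_closed[OF A] by (auto simp: nearest_def)
  obtain u where u: "u \<in> nearest x A" using nearest_nonempty coset_nonempty[OF A] by blast
  then have uA: "u \<in> A" and uc: "u \<in> carrier G" and xu: "gdist x u = gdist_to x A"
    using nearest_subset nearest_closed[OF A] by (auto simp: nearest_def)
  have "gdist x a \<le> gdist_to x A + 1"
    using gdist_triangle[OF x uc ac] gdist_coset[OF A uA aA] xu by simp
  then have "\<not> crosses k B x a"
    using gdist_if_crosses[OF B x ac] before by auto
  then have "crosses k B a y" using far_imp_crosses_either[OF B x y By, of a] by blast
  then have ay: "gdist a y = gdist_to a B + 1 + gdist_to y B" by (rule gdist_if_crosses[OF B ac y])
  have cyB: "crosses k B x y" using far_imp_crosses[OF B x y By] .
  obtain v where v: "v \<in> nearest a B" using nearest_nonempty coset_nonempty[OF B] by blast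
  obtain w where w: "w \<in> nearest z B" using nearest_nonempty coset_nonempty[OF B] by blast
  have vB: "v \<in> B" "w \<in> B" using v w nearest_subset by blast+
  have vc: "v \<in> carrier G" "w \<in> carrier G" using v w nearest_closed[OF B] by blast+
  have "gdist a z \<le> gdist_to a B + 1 + gdist_to z B"
    using gdist_triangle[OF ac vc(1) z] gdist_triangle[OF vc z] gdist_coset[OF B vB]
      gdist_commute[OF vc(2) z] v w by (simp add: nearest_def)
  then have "gdist a z \<le> gdist_to z A"
    using ay ya gdist_commute[OF ac y] gdist_if_crosses[OF A x y Ay] gdist_if_crosses[OF A x z Az]
      gdist_if_crosses[OF B x y cyB] gdist_if_crosses[OF B x z Bz] by linarith
  then show "a \<in> nearest z A"
    using gdist_to_le[OF aA, of z] gdist_commute[OF ac z] aA by (simp add: nearest_def)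
qed

text \<open>The threshold \<open>7 C\<close> is half of the threshold \<open>14 C\<close> for separation, and exceeds the \<open>5 C\<close> that
  forces geodesics to cross.\<close>

definition branching :: "'g \<Rightarrow> 'g \<Rightarrow> 'g \<Rightarrow> ('l \<times> 'g set) set" where
  "branching x y z = {(l, A). coset l A \<and> far l A (7 * C) x y \<and> far l A (7 * C) x z \<and>
     nearest y A \<noteq> nearest z A}"

text \<open>Of two such cosets, the one closer to \<open>x\<close> would have equal projections of \<open>y\<close> and \<open>z\<close>, and at the
  same distance from \<open>x\<close> they coincide.\<close>

lemma branching_unique:
  assumes x: "x \<in> carrier G" and y: "y \<in> carrier G" and z: "z \<in> carrier G"
    and "c \<in> branching x y z" "d \<in> branching x y z"
  shows "c = d"
proof -
  have not_before: "\<not> gdist_to x A < gdist_to x B"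
    if "(l, A) \<in> branching x y z" "(k, B) \<in> branching x y z" for l A k B
  proof
    assume before: "gdist_to x A < gdist_to x B"
    have A: "coset l A" and B: "coset k B" and ne: "nearest y A \<noteq> nearest z A"
      using that by (auto simp: branching_def)
    have "far l A (5 * C) x y" "far l A (5 * C) x z" "far k B (5 * C) x y" "far k B (5 * C) x z"
      using that C_pos by (auto simp: branching_def intro: far_mono)
    then have "crosses l A x y" "crosses l A x z" "crosses k B x y" "crosses k B x z"
      "far k B (5 * C) x y" "far k B (5 * C) x z"
      using far_imp_crosses A B x y z by blast+
    then have "nearest y A = nearest z A"
      using nearest_subset_before_branching[OF A B x y z _ _ _ _ before]
        nearest_subset_before_branching[OF A B x z y _ _ _ _ before] by blast
    with ne show False ..
  qed
  obtain l A k B where c: "c = (l, A)" and d: "d = (k, B)" by (cases c, cases d)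
  have "gdist_to x A = gdist_to x B"
    using not_before assms(4,5) unfolding c d by (meson linorder_neqE_nat)
  moreover have AB: "coset l A" "coset k B" and "far l A (5 * C) x y" "far k B (5 * C) x y"
    using assms(4,5) C_pos unfolding c d by (auto simp: branching_def intro: far_mono)
  moreover have "crosses l A x y" "crosses k B x y"
    using calculation far_imp_crosses x y by blast+
  ultimately show ?thesis
    using crossed_coset_determined[of l A k B x y] x y c d by simp
qed

text \<open>The threshold has to be below \<open>15 C\<close>, so that the contribution of a coset that does not separate
  is bounded by the constant \<open>K\<^sub>l\<close>.\<close>

definition separating :: "'g \<Rightarrow> 'g \<Rightarrow> ('l \<times> 'g set) set" where
  "separating x y = {(l, A). coset l A \<and> far l A (14 * C) x y}"

lemma finite_separating:
  assumes "x \<in> carrier G" "y \<in> carrier G"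
  shows "finite (separating x y)"
proof (rule finite_subset)
  show "separating x y \<subseteq> {(l, A). coset l A \<and> crosses l A x y}"
    using far_imp_crosses assms far_mono[of _ _ "14 * C" x y "5 * C"] C_pos
    by (auto simp: separating_def)
qed (rule finite_crossed[OF assms])

lemma separating_commute: "separating x y = separating y x"
  using far_sym_iff by (auto simp: separating_def)

text \<open>Of the three projections of \<open>x\<close>, \<open>y\<close>, \<open>z\<close> to \<open>A\<close>, two are at relative distance more than
  \<open>14 C\<close>; the third is at distance more than \<open>7 C\<close> from one of these.\<close>

lemma separating_imp_branching:
  assumes "(l, A) \<in> separating x y \<union> separating y z \<union> separating z x"
    and "nearest x A \<noteq> nearest y A" "nearest y A \<noteq> nearest z A" "nearest z A \<noteq> nearest x A"
  shows "(l, A) \<in> branching x y z \<union> branching y z x \<union> branching z x y"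
proof -
  have A: "coset l A" using assms(1) by (auto simp: separating_def)
  have "far l A (7 * C) u v \<and> (far l A (7 * C) u w \<or> far l A (7 * C) w v)"
    if "(l, A) \<in> separating u v" for u v w
    using that far_split[of l A "7 * C" "7 * C" u v w] far_mono[of l A "14 * C" u v "7 * C"] C_pos
    by (auto simp: separating_def)
  then show ?thesis
    using assms A far_sym_iff[OF A] unfolding branching_def by blast
qed

lemma gdist_to_translate:
  assumes "g \<in> carrier G" "x \<in> carrier G" "A \<subseteq> carrier G"
  shows "gdist_to (g \<otimes> x) (g <# A) = gdist_to x A"
proof -
  have "(\<exists>a\<in>g <# A. gdist (g \<otimes> x) a = n) \<longleftrightarrow> (\<exists>a\<in>A. gdist x a = n)" for n
    using assms gdist_translate by (auto simp: l_coset_def subset_iff)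
  then show ?thesis by (simp add: gdist_to_def)
qed

lemma nearest_translate:
  assumes "g \<in> carrier G" "x \<in> carrier G" "A \<subseteq> carrier G"
  shows "nearest (g \<otimes> x) (g <# A) = (\<lambda>a. g \<otimes> a) ` nearest x A"
  unfolding nearest_def gdist_to_translate[OF assms]
  using assms gdist_translate by (auto simp: l_coset_def subset_iff)

lemma separating_translate:
  assumes g: "g \<in> carrier G" and x: "x \<in> carrier G" and y: "y \<in> carrier G"
    and "(l, A) \<in> separating x y"
  shows "(l, g <# A) \<in> separating (g \<otimes> x) (g \<otimes> y)"
proof -
  have A: "coset l A" and f: "far l A (14 * C) x y" using assms(4) by (auto simp: separating_def)
  obtain a b where "a \<in> nearest x A" "b \<in> nearest y A" "\<not> near l (14 * C) a b"
    using f by (auto simp: far_def)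
  then have "far l (g <# A) (14 * C) (g \<otimes> x) (g \<otimes> y)"
    unfolding far_def nearest_translate[OF g x coset_subset[OF A]]
      nearest_translate[OF g y coset_subset[OF A]]
    using near_translate[OF g nearest_closed[OF A] nearest_closed[OF A]] by blast
  then show ?thesis using coset_translate[OF g A] by (simp add: separating_def)
qed

lemma nearest_own:
  assumes "coset l A" "x \<in> A"
  shows "nearest x A = {x}"
proof -
  have xc: "x \<in> carrier G" using assms coset_subset by blast
  have "gdist_to x A = 0" using gdist_to_le[OF assms(2), of x] xc by simp
  then show ?thesis
    using assms gdist_eq_0[OF xc] xc coset_subset[OF assms(1)] by (auto simp: nearest_def)
qed

text \<open>For \<open>g \<noteq> 1\<close> the edge labelled by \<open>g \<in> H\<^sub>l\<close> is a geodesic, and it meets no coset but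
  \<open>H\<^sub>l\<close> along an edge of the corresponding subgroup.\<close>

lemma separating_on_H:
  assumes l: "l \<in> \<Lambda>" and g: "g \<in> H l"
  shows "separating \<one> g = (if near l (14 * C) \<one> g then {} else {(l, H l)})"
proof -
  have gc: "g \<in> carrier G" using H_closed[OF l g] .
  note own = nearest_own[OF coset_own[OF l]]
  have far_iff: "far l (H l) (14 * C) \<one> g \<longleftrightarrow> \<not> near l (14 * C) \<one> g"
    using own[OF H_one[OF l]] own[OF g] by (simp add: far_def)
  have "k = l \<and> A = H l" if "(k, A) \<in> separating \<one> g" for k A
  proof -
    have A: "coset k A" and f: "far k A (14 * C) \<one> g" using that by (auto simp: separating_def)
    have cr: "crosses k A \<one> g"
      using far_imp_crosses[OF A one_closed gc] far_mono[OF f] C_pos by simp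
    then have g1: "g \<noteq> \<one>" using not_crosses_self by blast
    let ?e = "(HLetter l g, True) :: ('g, 'l) letter \<times> bool"
    have "fst ?e \<in> alphabet G \<Lambda> H X" using HLetter_in_alphabet[OF l g g1] by simp
    moreover have "gdist \<one> g = 1"
      using gdist_coset[OF coset_own[OF l] H_one[OF l] g] gdist_eq_0[OF one_closed gc] g1 by auto
    ultimately have "geodesic \<one> [?e] g" using gc by (simp add: geodesic_def step_elt_def)
    then have "is_HLetter k (fst ?e)" "\<one> \<in> A"
      using crosses_edge(2-)[OF A cr, of "[?e]"] by simp_all
    then have "k = l" "\<one> \<in> A" by simp_all
    then show ?thesis using coset_eqI[OF A _ _ H_one[OF l]] coset_own[OF l] by blast
  qed
  then have "separating \<one> g \<subseteq> {(l, H l)}" by auto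
  moreover have "(l, H l) \<in> separating \<one> g \<longleftrightarrow> \<not> near l (14 * C) \<one> g"
    using far_iff coset_own[OF l] by (simp add: separating_def)
  ultimately show ?thesis by auto
qed

end

section \<open>Averages in normed modules\<close>

context normed_space_over
begin

lemma F_closed:
  shows F_add: "c \<in> F \<Longrightarrow> d \<in> F \<Longrightarrow> c + d \<in> F" and F_one: "1 \<in> F" and F_zero: "0 \<in> F"
    and F_minus_one: "-1 \<in> F"
    and F_inverse: "c \<in> F \<Longrightarrow> inverse c \<in> F"
proof -
  interpret S: subfield F complex_ring by (rule subfield_F)
  show add: "c \<in> F \<Longrightarrow> d \<in> F \<Longrightarrow> c + d \<in> F" for c d
    using subgroup.m_closed[OF S.subgroup_axioms] by (simp add: complex_ring_def)
  show one: "1 \<in> F" using S.one_closed by (simp add: complex_ring_def)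
  show zero: "0 \<in> F" using S.subgroup_axioms subgroup.one_closed
    by (fastforce simp: complex_ring_def)
  have "inv\<^bsub>add_monoid complex_ring\<^esub> 1 \<in> F"
    using one S.subgroup_axioms subgroup.m_inv_closed by fastforce
  moreover have "inv\<^bsub>add_monoid complex_ring\<^esub> (1 :: complex) = -1"
    unfolding m_inv_def complex_ring_def
    by (rule the_equality) (auto simp: add_eq_0_iff)
  ultimately show "-1 \<in> F" by simp
  show "inverse c \<in> F" if c: "c \<in> F"
  proof (cases "c = 0")
    case True
    then show ?thesis using zero by simp
  next
    case False
    then have "c \<in> Units (complex_ring\<lparr>carrier := F\<rparr>)"
      using S.subfield_Units c by (simp add: complex_ring_def)
    then obtain d where "d \<in> F" "c * d = 1"
      by (auto simp: Units_def complex_ring_def)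
    then show ?thesis using inverse_unique by metis
  qed
qed

lemma F_of_nat: "of_nat n \<in> F"
  by (induction n) (simp_all add: F_zero F_one F_add)

lemma scale_zero [simp]: "c \<in> F \<Longrightarrow> scale c 0 = 0"
  using scale_right_distrib[of c 0 0] by simp

lemma scale_minus: "c \<in> F \<Longrightarrow> scale c (- v) = - scale c v"
  using scale_right_distrib[of c v "- v"] by (simp add: eq_neg_iff_add_eq_0 add.commute)

lemma scale_sum: "c \<in> F \<Longrightarrow> scale c (\<Sum>x\<in>S. f x) = (\<Sum>x\<in>S. scale c (f x))"
  by (induction S rule: infinite_finite_induct) (simp_all add: scale_right_distrib)

lemma scale_zero_left: "scale 0 v = 0"
  using scale_left_distrib[OF F_zero F_zero, of v] by simp

lemma scale_minus_one: "scale (-1) v = - v"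
  using scale_left_distrib[OF F_one F_minus_one, of v]
  by (simp add: scale_one scale_zero_left eq_neg_iff_add_eq_0 add.commute)

lemma nrm_zero [simp]: "nrm 0 = 0"
  using nrm_eq_0_iff by blast

lemma nrm_minus [simp]: "nrm (- v) = nrm v"
  using nrm_scale[OF F_minus_one, of v] by (simp add: scale_minus_one)

lemma nrm_diff: "nrm (v - w) \<le> nrm v + nrm w"
  using nrm_triangle[of v "- w"] by simp

lemma nrm_sum_le: "nrm (\<Sum>x\<in>S. f x) \<le> (\<Sum>x\<in>S. nrm (f x))"
proof (induction S rule: infinite_finite_induct)
  case (insert x S)
  then show ?case using nrm_triangle[of "f x" "sum f S"] by simp
qed simp_all

lemma sum_const: "finite S \<Longrightarrow> (\<Sum>x\<in>S. v) = scale (of_nat (card S)) v"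
  by (induction S rule: finite_induct)
    (simp_all add: scale_zero_left scale_left_distrib F_one F_of_nat scale_one)

text \<open>The weight is a rational number, hence a scalar in \<open>F\<close>. An average, rather than the value
  at a chosen nearest point, keeps the construction equivariant while it depends on the endpoints only
  through their projections.\<close>

definition avg :: "'a set \<Rightarrow> ('a \<Rightarrow> 'v) \<Rightarrow> 'v" where
  "avg S f = scale (inverse (of_nat (card S))) (\<Sum>x\<in>S. f x)"

lemma weight_in_F: "inverse (of_nat (card S)) \<in> F"
  using F_of_nat F_inverse by blast

lemma avg_const:
  assumes "finite S" "S \<noteq> {}"
  shows "avg S (\<lambda>x. v) = v"
  using assms scale_scale[OF weight_in_F[of S] F_of_nat[of "card S"], of v]
  by (simp add: avg_def sum_const scale_one)

lemma avg_cong: "(\<And>x. x \<in> S \<Longrightarrow> f x = g x) \<Longrightarrow> avg S f = avg S g"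
  by (simp add: avg_def)

lemma avg_singleton [simp]: "avg {x} f = f x"
  by (simp add: avg_def scale_one)

lemma avg_add: "avg S (\<lambda>x. f x + g x) = avg S f + avg S g"
  by (simp add: avg_def sum.distrib scale_right_distrib weight_in_F)

lemma avg_uminus: "avg S (\<lambda>x. - f x) = - avg S f"
  by (simp add: avg_def sum_negf scale_minus weight_in_F)

lemma scale_avg: "c \<in> F \<Longrightarrow> scale c (avg S f) = avg S (\<lambda>x. scale c (f x))"
  by (simp add: avg_def scale_sum scale_scale weight_in_F mult.commute flip: scale_sum)

lemma avg_swap: "avg S (\<lambda>x. avg T (\<lambda>y. f x y)) = avg T (\<lambda>y. avg S (\<lambda>x. f x y))"
  unfolding avg_def scale_sum[OF weight_in_F, symmetric] scale_scale[OF weight_in_F weight_in_F]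
  by (subst sum.swap) (simp add: mult.commute)

lemma avg_image: "inj_on h S \<Longrightarrow> avg (h ` S) f = avg S (\<lambda>x. f (h x))"
  by (simp add: avg_def card_image sum.reindex)

lemma nrm_avg_le:
  assumes "finite S" "S \<noteq> {}" and le: "\<And>x. x \<in> S \<Longrightarrow> nrm (f x) \<le> B"
  shows "nrm (avg S f) \<le> B"
proof -
  have n: "card S > 0" using assms card_gt_0_iff by blast
  have "nrm (sum f S) \<le> of_nat (card S) * B"
    using nrm_sum_le[of f S] sum_bounded_above[of S "\<lambda>x. nrm (f x)" B] le by fastforce
  then have "inverse (real (card S)) * nrm (sum f S) \<le> inverse (real (card S)) * (real (card S) * B)"
    by (intro mult_left_mono) simp_all
  also have "\<dots> = B" using n by simp
  finally have "inverse (real (card S)) * nrm (sum f S) \<le> B" .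
  then show ?thesis
    using nrm_scale[OF weight_in_F[of S], of "sum f S"]
    by (simp add: avg_def norm_inverse)
qed

end

section \<open>The bicombing of a family of quasi-cocycles\<close>

locale embedded_collection_module =
  embedded_collection G \<Lambda> H X C + normed_G_module F scale nrm G act
  for G :: "('g, 'm) monoid_scheme" (structure)
    and \<Lambda> :: "'l set" and H :: "'l \<Rightarrow> 'g set" and X :: "'g set" and C :: real
    and F :: "complex set" and scale :: "complex \<Rightarrow> 'v::ab_group_add \<Rightarrow> 'v"
    and nrm :: "'v \<Rightarrow> real" and act :: "'g \<Rightarrow> 'v \<Rightarrow> 'v" +
  fixes U :: "'l \<Rightarrow> 'v set"
begin

lemma act_mult: "g \<in> carrier G \<Longrightarrow> h \<in> carrier G \<Longrightarrow> act (g \<otimes> h) v = act g (act h v)"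
  using composition_rule by simp

lemma act_one [simp]: "act \<one> v = v"
  using id_eq_one by (metis UNIV_I restrict_apply')

lemma act_zero [simp]: "g \<in> carrier G \<Longrightarrow> act g 0 = 0"
  using act_add[of g 0 0] by simp

lemma act_minus: "g \<in> carrier G \<Longrightarrow> act g (- v) = - act g v"
  using act_add[of g v "- v"] by (simp add: eq_neg_iff_add_eq_0 add.commute)

lemma act_sum: "g \<in> carrier G \<Longrightarrow> act g (\<Sum>x\<in>S. f x) = (\<Sum>x\<in>S. act g (f x))"
  by (induction S rule: infinite_finite_induct) (simp_all add: act_add)

lemma act_avg: "g \<in> carrier G \<Longrightarrow> act g (avg S f) = avg S (\<lambda>x. act g (f x))"
  by (simp add: avg_def act_scale weight_in_F act_sum)

text \<open>The quasi-cocycle \<open>p\<close> on \<open>H\<^sub>l\<close> is carried to pairs of points of a left coset of \<open>H\<^sub>l\<close>, where its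
  defect becomes the failure of additivity around triangles.\<close>

definition transport :: "('g \<Rightarrow> 'v) \<Rightarrow> 'g \<Rightarrow> 'g \<Rightarrow> 'v" where
  "transport p a b = act a (p (inv a \<otimes> b))"

lemma transport_translate:
  "g \<in> carrier G \<Longrightarrow> a \<in> carrier G \<Longrightarrow> b \<in> carrier G \<Longrightarrow>
    transport p (g \<otimes> a) (g \<otimes> b) = act g (transport p a b)"
  by (simp add: transport_def inv_mult_group act_mult m_assoc)

context
  fixes l and p
  assumes l: "l \<in> \<Lambda>" and p: "p \<in> QZas G act nrm (H l) (U l)"
begin

lemma defect_bound:
  assumes "f \<in> H l" "g \<in> H l"
  shows "nrm (p (f \<otimes> g) - p f - act f (p g)) \<le> defect G act nrm (H l) p"
  unfolding defect_def
proof (rule cSup_upper)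
  show "nrm (p (f \<otimes> g) - p f - act f (p g)) \<in> defects G act nrm (H l) p"
    using assms by (auto simp: defects_def)
  show "bdd_above (defects G act nrm (H l) p)" using p by (simp add: QZas_def)
qed

lemma defect_nonneg: "0 \<le> defect G act nrm (H l) p"
  using defect_bound[OF H_one[OF l] H_one[OF l]] nrm_nonneg order_trans by blast

lemma transport_antisym:
  assumes A: "coset l A" and a: "a \<in> A" and b: "b \<in> A"
  shows "transport p b a = - transport p a b"
proof -
  have h: "inv a \<otimes> b \<in> H l" using coset_mem_iff[OF A a] b by blast
  have c: "a \<in> carrier G" "b \<in> carrier G" using A a b coset_subset by blast+
  have "p (inv (inv a \<otimes> b)) = - act (inv (inv a \<otimes> b)) (p (inv a \<otimes> b))"
    using p h by (simp add: QZas_def)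
  then show ?thesis
    using c by (simp add: transport_def inv_mult_group act_minus flip: act_mult)
qed

lemma transport_triangle:
  assumes A: "coset l A" and a: "a \<in> A" and b: "b \<in> A" and e: "e \<in> A"
  shows "nrm (transport p a b + transport p b e + transport p e a) \<le> defect G act nrm (H l) p"
proof -
  let ?f = "inv a \<otimes> b" and ?g = "inv b \<otimes> e"
  have h: "?f \<in> H l" "?g \<in> H l" using coset_mem_iff[OF A] a b e by blast+
  have c: "a \<in> carrier G" "b \<in> carrier G" "e \<in> carrier G" using A a b e coset_subset by blast+
  have fg: "?f \<otimes> ?g = inv a \<otimes> e" using c by (simp add: m_assoc)
  have "act a (p (?f \<otimes> ?g) - p ?f - act ?f (p ?g)) =
      transport p a e - transport p a b - transport p b e"
    using c unfolding fg
    by (simp add: transport_def act_add act_minus diff_conv_add_uminus flip: act_mult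
        del: add_uminus_conv_diff)
  also have "\<dots> = - (transport p a b + transport p b e + transport p e a)"
    using transport_antisym[OF A a e] by simp
  finally have "nrm (transport p a b + transport p b e + transport p e a) =
      nrm (act a (p (?f \<otimes> ?g) - p ?f - act ?f (p ?g)))"
    by (simp only: nrm_minus)
  then show ?thesis using defect_bound[OF h] c(1) by (simp add: act_isometry)
qed

lemma K_const_bound:
  assumes "g \<in> H l" "near l (14 * C) \<one> g"
  shows "nrm (p g) \<le> K_const G nrm \<Lambda> H X C l p"
  unfolding K_const_def
proof (rule Max_ge)
  let ?B = "{g \<in> H l. ereal_of_enat (rel_dist_ext G \<Lambda> H X l \<one> g) < ereal (15 * C)}"
  have "?B \<subseteq> {b \<in> carrier G. near l (15 * C) \<one> b}"
    using H_closed[OF l] by (auto simp: near_def)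
  then have "finite ?B" using finite_near[OF l one_closed] finite_subset by blast
  then show "finite {nrm (p g) |g. g \<in> H l \<and>
      ereal_of_enat (rel_dist_ext G \<Lambda> H X l \<one> g) < ereal (15 * C)}"
    by simp
  have "ereal_of_enat (rel_dist_ext G \<Lambda> H X l \<one> g) < ereal (15 * C)"
    using assms(2) C_pos unfolding near_def by (auto intro: le_less_trans)
  then show "nrm (p g) \<in> {nrm (p g) |g. g \<in> H l \<and>
      ereal_of_enat (rel_dist_ext G \<Lambda> H X l \<one> g) < ereal (15 * C)}"
    using assms(1) by blast
qed

lemma K_const_nonneg: "0 \<le> K_const G nrm \<Lambda> H X C l p"
proof -
  have "near l (14 * C) \<one> \<one>" using near_refl[OF l one_closed] C_pos by simp
  then show ?thesis using K_const_bound[OF H_one[OF l]] nrm_nonneg order_trans by blast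
qed

lemma transport_bound:
  assumes A: "coset l A" and a: "a \<in> A" and b: "b \<in> A" and "near l (14 * C) a b"
  shows "nrm (transport p a b) \<le> K_const G nrm \<Lambda> H X C l p"
proof -
  have h: "inv a \<otimes> b \<in> H l" using coset_mem_iff[OF A a] b by blast
  have c: "a \<in> carrier G" "b \<in> carrier G" using A a b coset_subset by blast+
  have "near l (14 * C) (inv a \<otimes> a) (inv a \<otimes> b)"
    using near_translate[of "inv a" a b] assms(4) c by simp
  then show ?thesis
    using K_const_bound[OF h] c by (simp add: transport_def act_isometry)
qed

end

definition passage :: "'g set \<Rightarrow> ('g \<Rightarrow> 'v) \<Rightarrow> 'g \<Rightarrow> 'g \<Rightarrow> 'v" where
  "passage A p x y = avg (nearest x A) (\<lambda>a. avg (nearest y A) (\<lambda>b. transport p a b))"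

lemma passage_translate:
  assumes "g \<in> carrier G" "x \<in> carrier G" "y \<in> carrier G" and A: "coset l A"
  shows "passage (g <# A) p (g \<otimes> x) (g \<otimes> y) = act g (passage A p x y)"
proof -
  have inj: "inj_on (\<lambda>a. g \<otimes> a) (nearest z A)" for z
    using assms(1) nearest_closed[OF A] by (auto intro!: inj_onI)
  have "passage (g <# A) p (g \<otimes> x) (g \<otimes> y) =
    avg (nearest x A) (\<lambda>a. avg (nearest y A) (\<lambda>b. transport p (g \<otimes> a) (g \<otimes> b)))"
    unfolding passage_def nearest_translate[OF assms(1,2) coset_subset[OF A]]
      nearest_translate[OF assms(1,3) coset_subset[OF A]] avg_image[OF inj] ..
  also have "\<dots> = avg (nearest x A) (\<lambda>a. avg (nearest y A) (\<lambda>b. act g (transport p a b)))"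
    using transport_translate[OF assms(1)] nearest_closed[OF A] by (intro avg_cong) blast
  also have "\<dots> = act g (passage A p x y)"
    by (simp add: passage_def act_avg assms(1))
  finally show ?thesis .
qed

lemma passage_add: "passage A (\<lambda>g. p g + p' g) x y = passage A p x y + passage A p' x y"
  if "coset l A"
proof -
  have "transport (\<lambda>g. p g + p' g) a b = transport p a b + transport p' a b"
    if "a \<in> nearest x A" for a b
    using nearest_closed[OF \<open>coset l A\<close> that] by (simp add: transport_def act_add)
  then show ?thesis by (simp add: passage_def cong: avg_cong) (simp add: avg_add)
qed

lemma passage_scale: "passage A (\<lambda>g. scale c (p g)) x y = scale c (passage A p x y)"
  if "coset l A" "c \<in> F"
proof -
  have "transport (\<lambda>g. scale c (p g)) a b = scale c (transport p a b)"
    if "a \<in> nearest x A" for a b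
    using nearest_closed[OF \<open>coset l A\<close> that] \<open>c \<in> F\<close> by (simp add: transport_def act_scale)
  then show ?thesis by (simp add: passage_def scale_avg[OF \<open>c \<in> F\<close>] cong: avg_cong)
qed

context
  fixes l p A
  assumes p: "p \<in> QZas G act nrm (H l) (U l)" and A: "coset l A"
begin

lemma passage_antisym: "passage A p y x = - passage A p x y"
proof -
  have "passage A p y x = avg (nearest y A) (\<lambda>b. avg (nearest x A) (\<lambda>a. - transport p a b))"
    unfolding passage_def
    using transport_antisym[OF coset_index[OF A] p A] nearest_subset by (intro avg_cong) blast
  also have "\<dots> = - passage A p x y"
    unfolding passage_def avg_uminus by (subst avg_swap) (rule refl)
  finally show ?thesis .
qed

text \<open>Averaging over the nearest points of the third vertex changes nothing, so the sum of the three
  averages is the average of the sums over triples of nearest points.\<close>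

lemma passage_triangle:
  assumes x: "x \<in> carrier G" and y: "y \<in> carrier G" and z: "z \<in> carrier G"
  shows "nrm (passage A p x y + passage A p y z + passage A p z x) \<le> defect G act nrm (H l) p"
proof -
  let ?X = "nearest x A" and ?Y = "nearest y A" and ?Z = "nearest z A" and ?t = "transport p"
  have fin: "finite ?X" "finite ?Y" "finite ?Z" using finite_nearest[OF A] x y z by blast+
  have ne: "?X \<noteq> {}" "?Y \<noteq> {}" "?Z \<noteq> {}" using nearest_nonempty coset_nonempty[OF A] by blast+
  have xy: "passage A p x y = avg ?X (\<lambda>a. avg ?Y (\<lambda>b. avg ?Z (\<lambda>e. ?t a b)))"
    by (simp add: passage_def avg_const[OF fin(3) ne(3)])
  have yz: "passage A p y z = avg ?X (\<lambda>a. avg ?Y (\<lambda>b. avg ?Z (\<lambda>e. ?t b e)))"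
    by (simp add: passage_def avg_const[OF fin(1) ne(1)])
  have "passage A p z x = avg ?X (\<lambda>a. avg ?Z (\<lambda>e. ?t e a))"
    unfolding passage_def by (rule avg_swap)
  then have zx: "passage A p z x = avg ?X (\<lambda>a. avg ?Y (\<lambda>b. avg ?Z (\<lambda>e. ?t e a)))"
    by (simp add: avg_const[OF fin(2) ne(2)])
  have "passage A p x y + passage A p y z + passage A p z x =
      avg ?X (\<lambda>a. avg ?Y (\<lambda>b. avg ?Z (\<lambda>e. ?t a b + ?t b e + ?t e a)))"
    unfolding xy yz zx avg_add ..
  also have "nrm \<dots> \<le> defect G act nrm (H l) p"
    using transport_triangle[OF coset_index[OF A] p A] nearest_subset
    by (intro nrm_avg_le fin ne) blast
  finally show ?thesis .
qed

lemma passage_bound: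
  assumes x: "x \<in> carrier G" and y: "y \<in> carrier G" and "\<not> far l A (14 * C) x y"
  shows "nrm (passage A p x y) \<le> K_const G nrm \<Lambda> H X C l p"
  unfolding passage_def
proof (intro nrm_avg_le finite_nearest[OF A] nearest_nonempty coset_nonempty[OF A] x y)
  fix a b assume "a \<in> nearest x A" "b \<in> nearest y A"
  then show "nrm (transport p a b) \<le> K_const G nrm \<Lambda> H X C l p"
    using transport_bound[OF coset_index[OF A] p A] assms(3) nearest_subset
    unfolding far_def by blast
qed

end

definition bicombing :: "('l \<Rightarrow> 'g \<Rightarrow> 'v) \<Rightarrow> 'g \<Rightarrow> 'g \<Rightarrow> 'v" where
  "bicombing q x y = (\<Sum>(l, A)\<in>separating x y. passage A (q l) x y)"

lemma bicombing_translate: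
  assumes g: "g \<in> carrier G" and x: "x \<in> carrier G" and y: "y \<in> carrier G"
  shows "bicombing q (g \<otimes> x) (g \<otimes> y) = act g (bicombing q x y)"
proof -
  have cancel: "inv g <# (g <# A) = A" "g <# (inv g <# A) = A" if "A \<subseteq> carrier G" for A
    using that g by (simp_all add: lcos_m_assoc lcos_mult_one)
  have "bicombing q (g \<otimes> x) (g \<otimes> y) = (\<Sum>(l, A)\<in>separating x y. act g (passage A (q l) x y))"
    unfolding bicombing_def
  proof (rule sum.reindex_bij_witness[of _ "\<lambda>(l, A). (l, g <# A)" "\<lambda>(l, A). (l, inv g <# A)"])
    fix c assume c: "c \<in> separating (g \<otimes> x) (g \<otimes> y)"
    obtain l A where c_eq: "c = (l, A)" by (cases c)
    have A: "coset l A" using c c_eq by (simp add: separating_def)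
    note A' = coset_translate[OF inv_closed[OF g] A]
    show "(case case c of (l, A) \<Rightarrow> (l, inv g <# A) of (l, A) \<Rightarrow> (l, g <# A)) = c"
      using cancel coset_subset[OF A] c_eq by simp
    show "(case c of (l, A) \<Rightarrow> (l, inv g <# A)) \<in> separating x y"
      using separating_translate[of "inv g" "g \<otimes> x" "g \<otimes> y" l A] c c_eq g x y by simp
    show "(case case c of (l, A) \<Rightarrow> (l, inv g <# A) of (l, A) \<Rightarrow> act g (passage A (q l) x y)) =
      (case c of (l, A) \<Rightarrow> passage A (q l) (g \<otimes> x) (g \<otimes> y))"
      using passage_translate[OF g x y A', of "q l"] cancel coset_subset[OF A] c_eq by simp
  next
    fix c assume c: "c \<in> separating x y"
    obtain l A where c_eq: "c = (l, A)" by (cases c)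
    have A: "coset l A" using c c_eq by (simp add: separating_def)
    show "(case case c of (l, A) \<Rightarrow> (l, g <# A) of (l, A) \<Rightarrow> (l, inv g <# A)) = c"
      using cancel coset_subset[OF A] c_eq by simp
    show "(case c of (l, A) \<Rightarrow> (l, g <# A)) \<in> separating (g \<otimes> x) (g \<otimes> y)"
      using separating_translate[OF g x y] c c_eq by simp
  qed
  then show ?thesis by (simp add: bicombing_def act_sum[OF g] case_prod_unfold)
qed

lemma bicombing_add:
  "bicombing (\<lambda>l g. q l g + q' l g) x y = bicombing q x y + bicombing q' x y"
  unfolding bicombing_def sum.distrib[symmetric]
  by (rule sum.cong) (auto simp: separating_def passage_add)

lemma bicombing_scale:
  "c \<in> F \<Longrightarrow> bicombing (\<lambda>l g. scale c (q l g)) x y = scale c (bicombing q x y)"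
  unfolding bicombing_def scale_sum
  by (rule sum.cong) (auto simp: separating_def passage_scale)

context
  fixes q
  assumes q: "q \<in> QZas_sum G act nrm \<Lambda> H U"
begin

lemma q_QZas: "l \<in> \<Lambda> \<Longrightarrow> q l \<in> QZas G act nrm (H l) (U l)"
  using q by (simp add: QZas_sum_def)

lemma support:
  shows finite_support: "finite {l. q l \<noteq> (\<lambda>_. 0)}"
    and support_subset: "{l. q l \<noteq> (\<lambda>_. 0)} \<subseteq> \<Lambda>"
  using q by (auto simp: QZas_sum_def)

text \<open>Bounds that hold for each index of the family are used through the sum over its support.\<close>

lemma le_support_sum:
  assumes "q l \<noteq> (\<lambda>_. 0)" and "\<And>k. k \<in> \<Lambda> \<Longrightarrow> 0 \<le> B k"
  shows "B l \<le> (\<Sum>k\<in>{l. q l \<noteq> (\<lambda>_. 0)}. (B k :: real))"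
  using assms support_subset by (intro member_le_sum finite_support) auto

lemma bicombing_antisym: "bicombing q y x = - bicombing q x y"
  unfolding bicombing_def separating_commute[of y x] sum_negf[symmetric]
  by (rule sum.cong) (auto simp: separating_def intro: passage_antisym q_QZas coset_index)

text \<open>Only cosets at which the three projections differ contribute: if \<open>y\<close> and \<open>z\<close> have the same
  projection, the passages \<open>x \<rightarrow> y\<close> and \<open>z \<rightarrow> x\<close> cancel and \<open>y \<rightarrow> z\<close> is too short to count. Each such
  coset is the only one at which geodesics from one of the three vertices branch, so at most three
  remain.\<close>

lemma bicombing_triangle:
  assumes x: "x \<in> carrier G" and y: "y \<in> carrier G" and z: "z \<in> carrier G"
  shows "nrm (bicombing q x y + bicombing q y z + bicombing q z x) \<le>
    3 * (\<Sum>l\<in>{l. q l \<noteq> (\<lambda>_. 0)}.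
      3 * K_const G nrm \<Lambda> H X C l (q l) + defect G act nrm (H l) (q l))"
proof -
  define P where "P = separating x y \<union> separating y z \<union> separating z x"
  define E where "E = branching x y z \<union> branching y z x \<union> branching z x y"
  define t where "t c u v = (if c \<in> separating u v then passage (snd c) (q (fst c)) u v else 0)" for c u v
  define T where "T c = t c x y + t c y z + t c z x" for c
  define B where "B l = 3 * K_const G nrm \<Lambda> H X C l (q l) + defect G act nrm (H l) (q l)" for l
  have B0: "0 \<le> B l" if "l \<in> \<Lambda>" for l
    using K_const_nonneg[OF that q_QZas[OF that]] defect_nonneg[OF that q_QZas[OF that]]
    by (simp add: B_def)
  define S where "S = (\<Sum>l\<in>{l. q l \<noteq> (\<lambda>_. 0)}. B l)"
  have S0: "0 \<le> S" unfolding S_def using B0 support_subset by (intro sum_nonneg) auto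
  have finP: "finite P" using finite_separating x y z by (simp add: P_def)
  have bic: "bicombing q u v = (\<Sum>c\<in>P. t c u v)" if "separating u v \<subseteq> P" for u v
    unfolding bicombing_def t_def using that finP
    by (intro sum.mono_neutral_cong_left) (auto simp: case_prod_unfold)
  have sum_T: "bicombing q x y + bicombing q y z + bicombing q z x = (\<Sum>c\<in>P. T c)"
  proof -
    have "separating x y \<subseteq> P" "separating y z \<subseteq> P" "separating z x \<subseteq> P" by (auto simp: P_def)
    then show ?thesis unfolding T_def sum.distrib by (simp only: bic)
  qed
  have T_le: "nrm (T c) \<le> S" if c: "c \<in> P" for c
  proof -
    obtain l A where c_eq: "c = (l, A)" by (cases c)
    have A: "coset l A" using c c_eq by (auto simp: P_def separating_def)
    note l = coset_index[OF A]
    note ql = q_QZas[OF l]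
    show ?thesis
    proof (cases "q l = (\<lambda>_. 0)")
      case True
      have "passage A (\<lambda>_. 0) u v = 0" for u v
        using passage_scale[OF A F_zero, of "\<lambda>_. 0" u v] by (simp add: scale_zero_left)
      then have "T c = 0" by (simp add: T_def t_def c_eq True)
      then show ?thesis using S0 by simp
    next
      case False
      \<comment> \<open>The truncation removes passages between projections at relative distance at most \<open>14 C\<close>.\<close>
      have dev: "nrm (passage A (q l) u v - t c u v) \<le> K_const G nrm \<Lambda> H X C l (q l)"
        if "u \<in> carrier G" "v \<in> carrier G" for u v
        using passage_bound[OF ql A that] K_const_nonneg[OF l ql] A
        by (auto simp: t_def c_eq separating_def)
      let ?p = "passage A (q l)"
      have split: "T c =
          ?p x y + ?p y z + ?p z x - (?p x y - t c x y) - (?p y z - t c y z) - (?p z x - t c z x)"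
        by (simp add: T_def)
      have "nrm (T c) \<le> nrm (?p x y + ?p y z + ?p z x) + nrm (?p x y - t c x y)
          + nrm (?p y z - t c y z) + nrm (?p z x - t c z x)"
        unfolding split by (intro order_trans[OF nrm_diff] add_right_mono order_refl)
      also have "\<dots> \<le> B l"
        using passage_triangle[OF ql A x y z] dev[OF x y] dev[OF y z] dev[OF z x]
        by (simp add: B_def)
      also have "\<dots> \<le> S" unfolding S_def by (rule le_support_sum[OF False B0])
      finally show ?thesis .
    qed
  qed
  have T_0: "T c = 0" if c: "c \<in> P - E" for c
  proof -
    obtain l A where c_eq: "c = (l, A)" by (cases c)
    have A: "coset l A" using c c_eq by (auto simp: P_def separating_def)
    note ql = q_QZas[OF coset_index[OF A]]
    have anti: "t c v u = - t c u v" for u v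
      using passage_antisym[OF ql A, where x = u and y = v] separating_commute[of u v]
      by (simp add: t_def c_eq)
    have short: "t c u v = 0" if "nearest u A = nearest v A" "u \<in> carrier G" for u v
    proof -
      have "\<not> far l A (14 * C) u v"
        using near_nearest[OF A that(2)] near_mono[of l "5 * C" _ _ "14 * C"] C_pos that(1)
        by (auto simp: far_def)
      then show ?thesis by (simp add: t_def c_eq separating_def)
    qed
    have same: "t c u w = t c v w" if "nearest u A = nearest v A" for u v w
      unfolding t_def c_eq separating_def far_def passage_def mem_Collect_eq prod.case fst_conv snd_conv that ..
    have "nearest x A = nearest y A \<or> nearest y A = nearest z A \<or> nearest z A = nearest x A"
      using separating_imp_branching[of l A x y z] c c_eq by (auto simp: P_def E_def)
    then show ?thesis
    proof (elim disjE)
      assume eq: "nearest x A = nearest y A"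
      then show ?thesis using short[OF eq x] same[OF eq, of z] anti[of z x] by (simp add: T_def)
    next
      assume eq: "nearest y A = nearest z A"
      then show ?thesis using short[OF eq y] same[OF eq, of x] anti[of x y] by (simp add: T_def)
    next
      assume eq: "nearest z A = nearest x A"
      then show ?thesis using short[OF eq z] same[OF eq, of y] anti[of y z] by (simp add: T_def)
    qed
  qed
  have small: "finite (branching u v w) \<and> card (branching u v w) \<le> 1"
    if "u \<in> carrier G" "v \<in> carrier G" "w \<in> carrier G" for u v w
  proof (cases "branching u v w = {}")
    case False
    then obtain c where "c \<in> branching u v w" by blast
    then have "branching u v w = {c}" using branching_unique[OF that] by blast
    then show ?thesis by simp
  qed simp
  have cardE: "card E \<le> 3"
    using card_Un_le[of "branching x y z \<union> branching y z x" "branching z x y"]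
      card_Un_le[of "branching x y z" "branching y z x"]
      small[OF x y z] small[OF y z x] small[OF z x y] by (simp add: E_def)
  have finE: "finite E" using small x y z by (simp add: E_def)
  have "nrm (\<Sum>c\<in>P. T c) = nrm (\<Sum>c\<in>P \<inter> E. T c)"
    using sum.mono_neutral_right[OF finP, of "P \<inter> E" T] T_0 by fastforce
  also have "\<dots> \<le> (\<Sum>c\<in>P \<inter> E. nrm (T c))" by (rule nrm_sum_le)
  also have "\<dots> \<le> real (card (P \<inter> E)) * S"
    using sum_bounded_above[of "P \<inter> E" "\<lambda>c. nrm (T c)" S] T_le by auto
  also have "\<dots> \<le> 3 * S"
    using card_mono[OF finE, of "P \<inter> E"] cardE S0 by (intro mult_right_mono) auto
  finally show ?thesis by (simp add: sum_T S_def B_def)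
qed

text \<open>Both projections to \<open>H l\<close> are single points, so the passage is \<open>q l g\<close> without averaging.\<close>

lemma bicombing_on_H:
  assumes l: "l \<in> \<Lambda>" and g: "g \<in> H l"
  shows "bicombing q \<one> g = (if near l (14 * C) \<one> g then 0 else q l g)"
proof -
  note A = coset_own[OF l]
  have "passage (H l) (q l) \<one> g = q l g"
    using nearest_own[OF A H_one[OF l]] nearest_own[OF A g] H_closed[OF l g]
    by (simp add: passage_def transport_def)
  then show ?thesis by (simp add: bicombing_def separating_on_H[OF l g])
qed

lemma bicombing_on_H_close:
  assumes l: "l \<in> \<Lambda>" and g: "g \<in> H l"
  shows "nrm (q l g - bicombing q \<one> g) \<le> (\<Sum>l\<in>{l. q l \<noteq> (\<lambda>_. 0)}. K_const G nrm \<Lambda> H X C l (q l))"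
proof (cases "q l = (\<lambda>_. 0)")
  case True
  have "0 \<le> (\<Sum>l\<in>{l. q l \<noteq> (\<lambda>_. 0)}. K_const G nrm \<Lambda> H X C l (q l))"
    using support_subset K_const_nonneg q_QZas by (intro sum_nonneg) auto
  then show ?thesis using True bicombing_on_H[OF l g] by simp
next
  case False
  have "nrm (q l g - bicombing q \<one> g) \<le> K_const G nrm \<Lambda> H X C l (q l)"
    using bicombing_on_H[OF l g] K_const_bound[OF l q_QZas[OF l] g] K_const_nonneg[OF l q_QZas[OF l]]
    by simp
  also have "\<dots> \<le> (\<Sum>l\<in>{l. q l \<noteq> (\<lambda>_. 0)}. K_const G nrm \<Lambda> H X C l (q l))"
    using le_support_sum[OF False, of "\<lambda>l. K_const G nrm \<Lambda> H X C l (q l)"] K_const_nonneg q_QZas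
    by blast
  finally show ?thesis .
qed

end

section \<open>The extension\<close>

text \<open>On the elements that belong to exactly one of the subgroups the value is prescribed. For an element
  of several subgroups the prescribed values may disagree; it gets the value of the bicombing, as do
  the elements outside of all subgroups.\<close>

definition extension :: "('l \<Rightarrow> 'g \<Rightarrow> 'v) \<Rightarrow> 'g \<Rightarrow> 'v" where
  "extension q g =
    (if \<exists>l\<in>\<Lambda>. g \<in> H l - overlap \<Lambda> H l then q (THE l. l \<in> \<Lambda> \<and> g \<in> H l - overlap \<Lambda> H l) g
     else if g \<in> carrier G then bicombing q \<one> g else 0)"

lemma extension_own:
  assumes "l \<in> \<Lambda>" "g \<in> H l - overlap \<Lambda> H l"
  shows "extension q g = q l g"
proof -
  have "(THE k. k \<in> \<Lambda> \<and> g \<in> H k - overlap \<Lambda> H k) = l"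
    using assms by (intro the_equality) (auto simp: overlap_def)
  then show ?thesis using assms by (auto simp: extension_def)
qed

lemma extension_not_own:
  "\<not> (\<exists>l\<in>\<Lambda>. g \<in> H l - overlap \<Lambda> H l) \<Longrightarrow>
    extension q g = (if g \<in> carrier G then bicombing q \<one> g else 0)"
  unfolding extension_def by (rule if_not_P)

lemma extension_add: "extension (\<lambda>l g. q l g + q' l g) g = extension q g + extension q' g"
proof (cases "\<exists>l\<in>\<Lambda>. g \<in> H l - overlap \<Lambda> H l")
  case True
  then show ?thesis by (auto simp: extension_own)
next
  case False
  then show ?thesis by (simp only: extension_not_own[OF False]) (simp add: bicombing_add)
qed

lemma extension_scale:
  assumes "c \<in> F"
  shows "extension (\<lambda>l g. scale c (q l g)) g = scale c (extension q g)"
proof (cases "\<exists>l\<in>\<Lambda>. g \<in> H l - overlap \<Lambda> H l")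
  case True
  then show ?thesis using assms by (auto simp: extension_own)
next
  case False
  then show ?thesis using assms
    by (simp only: extension_not_own[OF False]) (simp add: bicombing_scale)
qed

context
  fixes q
  assumes q: "q \<in> QZas_sum G act nrm \<Lambda> H U"
begin

lemma extension_close:
  assumes "g \<in> carrier G"
  shows "nrm (extension q g - bicombing q \<one> g) \<le>
    (\<Sum>l\<in>{l. q l \<noteq> (\<lambda>_. 0)}. K_const G nrm \<Lambda> H X C l (q l))"
proof (cases "\<exists>l\<in>\<Lambda>. g \<in> H l - overlap \<Lambda> H l")
  case True
  then obtain l where l: "l \<in> \<Lambda>" "g \<in> H l - overlap \<Lambda> H l" by blast
  then show ?thesis using extension_own[OF l] bicombing_on_H_close[OF q l(1)] by simp
next
  case False
  have "0 \<le> (\<Sum>l\<in>{l. q l \<noteq> (\<lambda>_. 0)}. K_const G nrm \<Lambda> H X C l (q l))"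
    using support_subset[OF q] K_const_nonneg q_QZas[OF q] by (intro sum_nonneg) auto
  then show ?thesis using extension_not_own[OF False] assms by simp
qed

lemma extension_close_on_H:
  assumes "l \<in> \<Lambda>" "h \<in> H l"
  shows "nrm (extension q h - q l h) \<le>
    2 * (\<Sum>l\<in>{l. q l \<noteq> (\<lambda>_. 0)}. K_const G nrm \<Lambda> H X C l (q l))"
proof -
  have "extension q h - q l h = (extension q h - bicombing q \<one> h) - (q l h - bicombing q \<one> h)"
    by simp
  then show ?thesis
    using nrm_diff[of "extension q h - bicombing q \<one> h" "q l h - bicombing q \<one> h"]
      extension_close[OF H_closed[OF assms]] bicombing_on_H_close[OF q assms] by simp
qed

text \<open>The elements with prescribed value are closed under inversion; at the others anti-symmetry
  comes from reversing the bicombing and translating it by \<open>g\<^sup>-\<^sup>1\<close>.\<close>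

lemma extension_antisym:
  assumes g: "g \<in> carrier G"
  shows "extension q (inv g) = - act (inv g) (extension q g)"
proof -
  have H_inv_iff: "inv g \<in> H l \<longleftrightarrow> g \<in> H l" if "l \<in> \<Lambda>" for l
    using H_inv[OF that, of g] H_inv[OF that, of "inv g"] g by auto
  have own_iff: "inv g \<in> H l - overlap \<Lambda> H l \<longleftrightarrow> g \<in> H l - overlap \<Lambda> H l" if "l \<in> \<Lambda>" for l
    using H_inv_iff that by (auto simp: overlap_def)
  show ?thesis
  proof (cases "\<exists>l\<in>\<Lambda>. g \<in> H l - overlap \<Lambda> H l")
    case True
    then obtain l where l: "l \<in> \<Lambda>" "g \<in> H l - overlap \<Lambda> H l" by blast
    then have "extension q (inv g) = q l (inv g)" using own_iff extension_own by blast
    then show ?thesis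
      using l extension_own[OF l] q_QZas[OF q l(1)] by (simp add: QZas_def)
  next
    case False
    then have "\<not> (\<exists>l\<in>\<Lambda>. inv g \<in> H l - overlap \<Lambda> H l)" using own_iff by blast
    then have "extension q (inv g) = bicombing q \<one> (inv g)"
      by (subst extension_not_own) (use g in simp_all)
    also have "\<dots> = act (inv g) (bicombing q g \<one>)"
      using bicombing_translate[of "inv g" g \<one> q] g by simp
    also have "\<dots> = - act (inv g) (bicombing q \<one> g)"
      using bicombing_antisym[OF q, of g \<one>] act_minus g by simp
    finally show ?thesis using extension_not_own[OF False] g by simp
  qed
qed

text \<open>The defect is the bicombing around the triangle \<open>1\<close>, \<open>f\<close>, \<open>fg\<close>, up to the three values that
  were corrected.\<close>

lemma extension_defect:
  assumes f: "f \<in> carrier G" and g: "g \<in> carrier G"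
  shows "nrm (extension q (f \<otimes> g) - extension q f - act f (extension q g)) \<le>
    (\<Sum>l\<in>{l. q l \<noteq> (\<lambda>_. 0)}.
      54 * K_const G nrm \<Lambda> H X C l (q l) + 66 * defect G act nrm (H l) (q l))"
    (is "_ \<le> (\<Sum>l\<in>?S. 54 * ?K l + 66 * ?D l)")
proof -
  let ?r = "bicombing q" and ?d = "\<lambda>g. extension q g - bicombing q \<one> g"
  have fg: "f \<otimes> g \<in> carrier G" using f g by simp
  have "act f (extension q g) = act f (?d g) + act f (?r \<one> g)"
    using act_add[OF f, of "?d g" "?r \<one> g"] by simp
  moreover have "act f (?r \<one> g) = ?r f (f \<otimes> g)"
    using bicombing_translate[OF f one_closed g, of q] f by simp
  moreover have "?r \<one> (f \<otimes> g) = - ?r (f \<otimes> g) \<one>" by (rule bicombing_antisym[OF q])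
  ultimately have split: "extension q (f \<otimes> g) - extension q f - act f (extension q g) =
      ?d (f \<otimes> g) - ?d f - act f (?d g) - (?r \<one> f + ?r f (f \<otimes> g) + ?r (f \<otimes> g) \<one>)"
    by simp
  have "nrm (extension q (f \<otimes> g) - extension q f - act f (extension q g)) \<le>
      nrm (?d (f \<otimes> g)) + nrm (?d f) + nrm (act f (?d g))
      + nrm (?r \<one> f + ?r f (f \<otimes> g) + ?r (f \<otimes> g) \<one>)"
    unfolding split by (intro order_trans[OF nrm_diff] add_right_mono order_refl)
  also have "\<dots> \<le> (\<Sum>l\<in>?S. ?K l) + (\<Sum>l\<in>?S. ?K l) + (\<Sum>l\<in>?S. ?K l)
      + 3 * (\<Sum>l\<in>?S. 3 * ?K l + ?D l)"
    using extension_close[OF fg] extension_close[OF f] extension_close[OF g]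
      bicombing_triangle[OF q one_closed f fg] act_isometry[OF f, of "?d g"]
    by (intro add_mono) simp_all
  also have "\<dots> = (\<Sum>l\<in>?S. 12 * ?K l + 3 * ?D l)"
    by (simp add: sum.distrib flip: sum_distrib_left)
  also have "\<dots> \<le> (\<Sum>l\<in>?S. 54 * ?K l + 66 * ?D l)"
  proof (rule sum_mono)
    fix l assume "l \<in> ?S"
    then have l: "l \<in> \<Lambda>" using support_subset[OF q] by blast
    show "12 * ?K l + 3 * ?D l \<le> 54 * ?K l + 66 * ?D l"
      using K_const_nonneg[OF l q_QZas[OF q l]] defect_nonneg[OF l q_QZas[OF q l]] by linarith
  qed
  finally show ?thesis .
qed

lemma extension_defect_le:
  shows "bdd_above (defects G act nrm (carrier G) (extension q))"
    and "defect G act nrm (carrier G) (extension q) \<le>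
      (\<Sum>l\<in>{l. q l \<noteq> (\<lambda>_. 0)}.
        54 * K_const G nrm \<Lambda> H X C l (q l) + 66 * defect G act nrm (H l) (q l))"
proof -
  show "bdd_above (defects G act nrm (carrier G) (extension q))"
    using extension_defect unfolding defects_def by (intro bdd_aboveI) blast
  have "defects G act nrm (carrier G) (extension q) \<noteq> {}" by (auto simp: defects_def)
  then show "defect G act nrm (carrier G) (extension q) \<le>
      (\<Sum>l\<in>{l. q l \<noteq> (\<lambda>_. 0)}.
        54 * K_const G nrm \<Lambda> H X C l (q l) + 66 * defect G act nrm (H l) (q l))"
    unfolding defect_def[of G act nrm "carrier G"]
    by (rule cSup_least) (auto simp: defects_def intro: extension_defect)
qed

lemma extension_QZas: "extension q \<in> QZas G act nrm (carrier G) UNIV"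
proof -
  have "extension q g = 0" if "g \<notin> carrier G" for g
    using that H_closed by (auto simp: extension_def)
  then show ?thesis
    using extension_defect_le(1) extension_antisym by (simp add: QZas_def)
qed

end

end

theorem theorem4p2:
  fixes G :: "('g, 'm) monoid_scheme"
    and \<Lambda> :: "'l set"
    and H :: "'l \<Rightarrow> 'g set"
    and X :: "'g set"
    and C :: real
    and F :: "complex set"
    and scale :: "complex \<Rightarrow> 'v::ab_group_add \<Rightarrow> 'v"
    and nrm :: "'v \<Rightarrow> real"
    and act :: "'g \<Rightarrow> 'v \<Rightarrow> 'v"
    and U :: "'l \<Rightarrow> 'v set"
  assumes "group G"
    and "hyp_embedded_wrt G \<Lambda> H X"
    and "C > 0"
    and "polygon_constant G \<Lambda> H X C"
    and "normed_G_module F scale nrm G act"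
    and "\<And>l. l \<in> \<Lambda> \<Longrightarrow> invariant_subspace F scale act (H l) (U l)"
  shows "\<exists>\<iota> :: ('l \<Rightarrow> 'g \<Rightarrow> 'v) \<Rightarrow> ('g \<Rightarrow> 'v).
           (\<forall>q\<in>QZas_sum G act nrm \<Lambda> H U. \<iota> q \<in> QZas G act nrm (carrier G) UNIV) \<and>
           (\<forall>q\<in>QZas_sum G act nrm \<Lambda> H U. \<forall>q'\<in>QZas_sum G act nrm \<Lambda> H U.
              \<iota> (\<lambda>l g. q l g + q' l g) = (\<lambda>g. \<iota> q g + \<iota> q' g)) \<and>
           (\<forall>c\<in>F. \<forall>q\<in>QZas_sum G act nrm \<Lambda> H U.
              \<iota> (\<lambda>l g. scale c (q l g)) = (\<lambda>g. scale c (\<iota> q g))) \<and>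
           (\<forall>q\<in>QZas_sum G act nrm \<Lambda> H U.
              (\<forall>l\<in>\<Lambda>. (\<forall>h \<in> H l - overlap \<Lambda> H l. \<iota> q h = q l h) \<and>
                     bdd_above ((\<lambda>h. nrm (\<iota> q h - q l h)) ` H l)) \<and>
              defect G act nrm (carrier G) (\<iota> q)
                \<le> (\<Sum>l\<in>{l. q l \<noteq> (\<lambda>_. 0)}.
                     54 * K_const G nrm \<Lambda> H X C l (q l) + 66 * defect G act nrm (H l) (q l)))"
proof -
  interpret embedded_collection_module G \<Lambda> H X C F scale nrm act U
    using assms(1-5)
    by (intro embedded_collection_module.intro embedded_collection.intro
        embedded_collection_axioms.intro)
  show ?thesis
  proof (intro exI[of _ extension] conjI ballI)
    fix q assume q: "q \<in> QZas_sum G act nrm \<Lambda> H U"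
    show "extension q \<in> QZas G act nrm (carrier G) UNIV" by (rule extension_QZas[OF q])
    show "defect G act nrm (carrier G) (extension q) \<le>
      (\<Sum>l\<in>{l. q l \<noteq> (\<lambda>_. 0)}.
        54 * K_const G nrm \<Lambda> H X C l (q l) + 66 * defect G act nrm (H l) (q l))"
      by (rule extension_defect_le(2)[OF q])
    fix l assume l: "l \<in> \<Lambda>"
    show "extension q h = q l h" if "h \<in> H l - overlap \<Lambda> H l" for h
      using extension_own[OF l that] .
    show "bdd_above ((\<lambda>h. nrm (extension q h - q l h)) ` H l)"
      using extension_close_on_H[OF q l] by (intro bdd_aboveI2) blast
  next
    fix q q' :: "'l \<Rightarrow> 'g \<Rightarrow> 'v"
    show "extension (\<lambda>l g. q l g + q' l g) = (\<lambda>g. extension q g + extension q' g)"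
      by (rule ext) (rule extension_add)
  next
    fix c and q :: "'l \<Rightarrow> 'g \<Rightarrow> 'v"
    assume "c \<in> F"
    then show "extension (\<lambda>l g. scale c (q l g)) = (\<lambda>g. scale c (extension q g))"
      by (intro ext extension_scale)
  qed
qed

end
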